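(* Let $(U,\Sigma,\mu)$ be a $\sigma$-finite measure space with a full ordered core $\mathcal A$. Then the couple $(\widetilde{L^1_\mu},L^\infty_\mu)$ has divisibility constant $1$.
   Context: Functions equal $\mu$-a.e. are identified. An ordered core of $(U,\Sigma,\mu)$ is a subset $\mathcal A\subseteq\Sigma$, totally ordered by inclusion, containing $\emptyset$, whose members all have finite $\mu$-measure. It is $\sigma$-bounded if $\bigcup\mathcal A=\bigcup\mathcal A_0$ for some countable $\mathcal A_0\subseteq\mathcal A$, and full if it is $\sigma$-bounded and $\bigcup\mathcal A=U$. $\sigma(\mathcal A)$ is the $\sigma$-ring generated by $\mathcal A$ (a $\sigma$-algebra on $U$ when $\mathcal A$ is full). Write $u\le_{\mathcal A}v$ if for all $A\in\mathcal A$, $v\in A$ implies $u\in A$. $L^\downarrow(\mathcal A)$ is the set of core decreasing functions: $\sigma(\mathcal A)$-measurable $f:U\to[0,\infty]$ with $f(u)\ge f(v)$ whenever $u\le_{\mathcal A}v$. A least core decreasing majorant of a $\Sigma$-measurable $g:U\to[-\infty,\infty]$ is a $\widetilde g\in L^\downarrow(\mathcal A)$ with $|g|\le\widetilde g$ $\mu$-a.e. and such that $\widetilde g\le h$ $\mu$-a.e. for every $h\in L^\downarrow(\mathcal A)$ with $|g|\le h$ $\mu$-a.e. (it exists and is unique $\mu$-a.e.). $\widetilde{L^1_\mu}$ is the Banach space of $\Sigma$-measurable $g$ with $\widetilde g\in L^1_\mu$, normed by $\|g\|_{\widetilde{L^1_\mu}}=\|\widetilde g\|_{L^1_\mu}$.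 For a compatible couple $(X_0,X_1)$ of Banach spaces, $K(f,t;X_0,X_1)=\inf\{\|f_0\|_{X_0}+t\|f_1\|_{X_1}:f_0+f_1=f\}$ for $f\in X_0+X_1$, $t\ge0$, and $\|f\|_{X_0+X_1}=K(f,1;X_0,X_1)$. The couple has divisibility constant $1$ if for all $f\in X_0+X_1$ and all nonnegative, concave functions $\omega_j$ ($j=1,2,\dots$) on $[0,\infty)$, the conditions $\sum_{j=1}^\infty\omega_j(1)<\infty$ and $K(f,t;X_0,X_1)\le\sum_{j=1}^\infty\omega_j(t)$ for all $t\ge0$ imply that there exist $f_j\in X_0+X_1$ such that $K(f_j,t;X_0,X_1)\le\omega_j(t)$ for all $j$ and $t$, and $\sum_{j=1}^\infty f_j$ converges to $f$ in $X_0+X_1$. *)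

theory Defs
  imports "HOL-Probability.Essential_Supremum" "HOL-Library.Function_Algebras"
begin

text \<open>Ordered cores. Throughout, \<open>U\<close> is \<^term>\<open>space M\<close>.\<close>

definition ordered_core :: "'a measure \<Rightarrow> 'a set set \<Rightarrow> bool" where
  "ordered_core M \<A> \<longleftrightarrow>
     \<A> \<subseteq> sets M \<and> (\<forall>A\<in>\<A>. \<forall>B\<in>\<A>. A \<subseteq> B \<or> B \<subseteq> A) \<and> {} \<in> \<A> \<and>
     (\<forall>A\<in>\<A>. emeasure M A < \<infinity>)"

definition sigma_bounded :: "'a set set \<Rightarrow> bool" where
  "sigma_bounded \<A> \<longleftrightarrow> (\<exists>\<A>0\<subseteq>\<A>. countable \<A>0 \<and> \<Union>\<A> = \<Union>\<A>0)"

definition full_ordered_core :: "'a measure \<Rightarrow> 'a set set \<Rightarrow> bool" where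
  "full_ordered_core M \<A> \<longleftrightarrow>
     ordered_core M \<A> \<and> sigma_bounded \<A> \<and> \<Union>\<A> = space M"

inductive_set generated_sigma_ring :: "'a set set \<Rightarrow> 'a set set" for \<A> :: "'a set set" where
  empty: "{} \<in> generated_sigma_ring \<A>"
| basic: "A \<in> \<A> \<Longrightarrow> A \<in> generated_sigma_ring \<A>"
| diff: "A \<in> generated_sigma_ring \<A> \<Longrightarrow> B \<in> generated_sigma_ring \<A>
           \<Longrightarrow> A - B \<in> generated_sigma_ring \<A>"
| union: "(\<And>i::nat. F i \<in> generated_sigma_ring \<A>)
           \<Longrightarrow> (\<Union>i. F i) \<in> generated_sigma_ring \<A>"

definition core_le :: "'a set set \<Rightarrow> 'a \<Rightarrow> 'a \<Rightarrow> bool" where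
  "core_le \<A> u v \<longleftrightarrow> (\<forall>A\<in>\<A>. v \<in> A \<longrightarrow> u \<in> A)"

text \<open>Measurability with respect to a \<open>\<sigma>\<close>-ring is taken in the usual sense, testing only Borel
  sets that omit \<open>0\<close>. If the core is full, the \<open>\<sigma>\<close>-ring is a \<open>\<sigma>\<close>-algebra on \<open>U\<close> and this is
  ordinary measurability.\<close>

definition core_decreasing :: "'a measure \<Rightarrow> 'a set set \<Rightarrow> ('a \<Rightarrow> ennreal) set" where
  "core_decreasing M \<A> = {f.
     (\<forall>B\<in>sets borel. 0 \<notin> B \<longrightarrow> f -` B \<inter> space M \<in> generated_sigma_ring \<A>) \<and>
     (\<forall>u\<in>space M. \<forall>v\<in>space M. core_le \<A> u v \<longrightarrow> f v \<le> f u)}"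

definition is_least_core_decreasing_majorant ::
    "'a measure \<Rightarrow> 'a set set \<Rightarrow> ('a \<Rightarrow> ereal) \<Rightarrow> ('a \<Rightarrow> ennreal) \<Rightarrow> bool" where
  "is_least_core_decreasing_majorant M \<A> g g' \<longleftrightarrow>
     g' \<in> core_decreasing M \<A> \<and> (AE u in M. e2ennreal \<bar>g u\<bar> \<le> g' u) \<and>
     (\<forall>h\<in>core_decreasing M \<A>. (AE u in M. e2ennreal \<bar>g u\<bar> \<le> h u) \<longrightarrow> (AE u in M. g' u \<le> h u))"

text \<open>For a full core of a \<open>\<sigma>\<close>-finite space the majorant of a measurable function exists and is
  unique up to null sets, so the choice below is harmless.\<close>

definition least_core_decreasing_majorant ::
    "'a measure \<Rightarrow> 'a set set \<Rightarrow> ('a \<Rightarrow> ereal) \<Rightarrow> 'a \<Rightarrow> ennreal" where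
  "least_core_decreasing_majorant M \<A> g = (SOME g'. is_least_core_decreasing_majorant M \<A> g g')"

text \<open>A space is given by its carrier and its norm (meaningful on the carrier only) inside an
  ambient group. Function spaces consist of representatives: a class modulo null sets is
  represented by any of its members, and the norm is a seminorm vanishing exactly on the members
  that are zero almost everywhere. Both spaces below contain all measurable functions that vanish
  almost everywhere, so decomposing \<open>f = f0 + f1\<close> pointwise is the same as decomposing almost
  everywhere. Members of either space are finite almost everywhere, so real-valued
  representatives suffice.\<close>

type_synonym 'v normed_carrier = "'v set \<times> ('v \<Rightarrow> real)"

definition L1_tilde :: "'a measure \<Rightarrow> 'a set set \<Rightarrow> ('a \<Rightarrow> real) normed_carrier" where
  "L1_tilde M \<A> =
    ({g \<in> borel_measurable M.
        (\<integral>\<^sup>+u. least_core_decreasing_majorant M \<A> (\<lambda>x. ereal (g x)) u \<partial>M) < \<infinity>},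
     \<lambda>g. enn2real (\<integral>\<^sup>+u. least_core_decreasing_majorant M \<A> (\<lambda>x. ereal (g x)) u \<partial>M))"

text \<open>The essential supremum is taken in \<^typ>\<open>ennreal\<close>, so that it is \<open>0\<close> and not \<open>-\<infinity>\<close> when
  \<open>M\<close> is the zero measure.\<close>

definition L_infinity :: "'a measure \<Rightarrow> ('a \<Rightarrow> real) normed_carrier" where
  "L_infinity M =
    ({g \<in> borel_measurable M. esssup M (\<lambda>u. ennreal \<bar>g u\<bar>) < \<infinity>},
     \<lambda>g. enn2real (esssup M (\<lambda>u. ennreal \<bar>g u\<bar>)))"

definition sum_space :: "'v::ab_group_add normed_carrier \<Rightarrow> 'v normed_carrier \<Rightarrow> 'v set" where
  "sum_space X0 X1 = {f0 + f1 | f0 f1. f0 \<in> fst X0 \<and> f1 \<in> fst X1}"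

definition K_functional ::
    "'v::ab_group_add normed_carrier \<Rightarrow> 'v normed_carrier \<Rightarrow> 'v \<Rightarrow> real \<Rightarrow> real" where
  "K_functional X0 X1 f t =
     Inf {snd X0 f0 + t * snd X1 f1 | f0 f1. f0 \<in> fst X0 \<and> f1 \<in> fst X1 \<and> f0 + f1 = f}"

definition sum_norm :: "'v::ab_group_add normed_carrier \<Rightarrow> 'v normed_carrier \<Rightarrow> 'v \<Rightarrow> real" where
  "sum_norm X0 X1 f = K_functional X0 X1 f 1"

text \<open>Sequences are indexed from \<open>0\<close>. A nonnegative concave function \<open>w\<close> on \<open>[0,\<infinity>)\<close> satisfies
  \<open>w t \<le> max 1 t * w 1\<close>, so summability at \<open>1\<close> gives convergence of the series at every \<open>t \<ge> 0\<close>.\<close>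

definition has_divisibility_constant_1 ::
    "'v::ab_group_add normed_carrier \<Rightarrow> 'v normed_carrier \<Rightarrow> bool" where
  "has_divisibility_constant_1 X0 X1 \<longleftrightarrow>
     (\<forall>f\<in>sum_space X0 X1. \<forall>\<omega> :: nat \<Rightarrow> real \<Rightarrow> real.
        (\<forall>j. (\<forall>t\<ge>0. 0 \<le> \<omega> j t) \<and> concave_on {0..} (\<omega> j)) \<longrightarrow>
        summable (\<lambda>j. \<omega> j 1) \<longrightarrow>
        (\<forall>t\<ge>0. K_functional X0 X1 f t \<le> (\<Sum>j. \<omega> j t)) \<longrightarrow>
        (\<exists>g :: nat \<Rightarrow> 'v.
           (\<forall>j. g j \<in> sum_space X0 X1) \<and>
           (\<forall>j. \<forall>t\<ge>0. K_functional X0 X1 (g j) t \<le> \<omega> j t) \<and>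
           (\<lambda>n. sum_norm X0 X1 ((\<Sum>j<n. g j) - f)) \<longlonglongrightarrow> 0))"

end

theory Submission
  imports Defs
begin

text \<open>
  Let \<open>\<Phi>\<close> be the least core decreasing majorant of \<open>f\<close>. Whenever \<open>f = f0 + f1\<close>, the function \<open>\<Phi>\<close>
  exceeds the majorant of \<open>f0\<close> by at most the norm of \<open>f1\<close>. Hence the K-functional of \<open>f\<close> at \<open>t\<close> is at
  least \<open>F t\<close>, the infimum over \<open>y\<close> of \<open>\<integral> (\<Phi> - y)\<^sub>+ + t * y\<close> (\<open>excess_transform_le_K\<close>). This \<open>F\<close> is
  concave, and under the hypothesis of divisibility it lies below the sum of the given concave
  functions. The problem moves to the half line.

  There, nonnegative concave functions have the Riesz decomposition property
  (\<open>nonneg_concave_decomposition\<close>): \<open>F\<close> is a sum of nonnegative concave functions, each below the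
  corresponding given one (\<open>nonneg_concave_countable_decomposition\<close>).

  The way back uses the position of a point \<open>x\<close>, the measure of the set where \<open>\<Phi> \<ge> \<Phi> x\<close>. A nonnegative
  concave \<open>G\<close> is turned into the function that sends \<open>x\<close> to the left derivative of \<open>G\<close> at the
  position of \<open>x\<close>. Three facts make this work.
  \<^item> The function obtained increases with the value of \<open>\<Phi>\<close>, so it is core decreasing together with
    all its truncations. Truncating at the height of a tangent shows that everything dominated by it
    has a K-functional of at most \<open>G\<close> (\<open>K_le_of_slope_bound\<close>).
  \<^item> Derivatives are additive (\<open>left_slope_add\<close>).
  \<^item> For \<open>G = F\<close> the function obtained is \<open>\<Phi>\<close> again, almost everywhere
    (\<open>AE_eq_left_slope_excess_transform\<close>).

  Dividing \<open>f\<close> in the proportions in which the derivatives of the summands divide the derivative of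
  \<open>F\<close> therefore gives the required series.
\<close>

section \<open>Nonnegative concave functions on the half line\<close>

text \<open>Testing concavity with affine minorants instead of convex combinations keeps products of
  unknowns out of the arguments below: minima, infima and pasting become immediate.\<close>

lemma concave_on_halfline_iff_affine:
  fixes f :: "real \<Rightarrow> real"
  shows "concave_on {0..} f \<longleftrightarrow>
    (\<forall>\<alpha> \<beta> x c y. 0 \<le> x \<and> x \<le> c \<and> c \<le> y \<and> \<alpha> + \<beta> * x \<le> f x \<and> \<alpha> + \<beta> * y \<le> f y
       \<longrightarrow> \<alpha> + \<beta> * c \<le> f c)" (is "?L \<longleftrightarrow> ?R")
proof
  assume conc: ?L
  show ?R
  proof (intro allI impI, elim conjE)
    fix \<alpha> \<beta> x c y :: real
    assume h: "0 \<le> x" "x \<le> c" "c \<le> y" "\<alpha> + \<beta> * x \<le> f x" "\<alpha> + \<beta> * y \<le> f y"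
    show "\<alpha> + \<beta> * c \<le> f c"
    proof (cases "x = y")
      case True
      then show ?thesis using h by auto
    next
      case False
      define u v where "u = (y - c) / (y - x)" and "v = (c - x) / (y - x)"
      have uv: "0 \<le> u" "0 \<le> v" "u + v = 1"
        using h False by (auto simp: u_def v_def add_divide_distrib[symmetric])
      have c: "u * x + v * y = c"
      proof -
        have "(u * x + v * y) * (y - x) = (y - c) * x + (c - x) * y"
          using False by (simp add: u_def v_def distrib_right)
        also have "\<dots> = c * (y - x)" by (simp add: algebra_simps)
        finally show ?thesis using False by simp
      qed
      have "u * f x + v * f y \<le> f (u * x + v * y)"
        using conc h uv by (auto simp: concave_on_iff)
      moreover have "u * (\<alpha> + \<beta> * x) \<le> u * f x" "v * (\<alpha> + \<beta> * y) \<le> v * f y"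
        using uv h by (auto intro: mult_left_mono)
      moreover have "u * (\<alpha> + \<beta> * x) + v * (\<alpha> + \<beta> * y) = (u + v) * \<alpha> + \<beta> * (u * x + v * y)"
        by (simp add: algebra_simps)
      ultimately show ?thesis using uv c by simp
    qed
  qed
next
  assume line: ?R
  show ?L
  proof (rule concave_on_linorderI)
    fix t x y :: real
    assume h: "0 < t" "t < 1" "x \<in> {0..}" "y \<in> {0..}" "x < y"
    define \<beta> where "\<beta> = (f y - f x) / (y - x)"
    have \<beta>: "\<beta> * (y - x) = f y - f x"
      using h by (simp add: \<beta>_def)
    define c where "c = (1 - t) * x + t * y"
    have c: "c - x = t * (y - x)" "y - c = (1 - t) * (y - x)"
      by (simp_all add: c_def algebra_simps)
    have "x \<le> c" "c \<le> y"
      using c h by (smt (verit) mult_nonneg_nonneg)+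
    then have "(f x - \<beta> * x) + \<beta> * c \<le> f c"
      using line[rule_format, of x c y "f x - \<beta> * x" \<beta>] h \<beta> by (auto simp: algebra_simps)
    moreover have "\<beta> * (c - x) = t * (\<beta> * (y - x))"
      by (simp add: c(1))
    then have "(f x - \<beta> * x) + \<beta> * c = f x + t * (\<beta> * (y - x))"
      by (simp add: algebra_simps)
    ultimately show "(1 - t) * f x + t * f y \<le> f ((1 - t) *\<^sub>R x + t *\<^sub>R y)"
      unfolding \<beta> c_def by (simp add: algebra_simps)
  qed auto
qed

definition nonneg_concave :: "(real \<Rightarrow> real) \<Rightarrow> bool" where
  "nonneg_concave G \<longleftrightarrow> (\<forall>t\<ge>0. 0 \<le> G t) \<and> concave_on {0..} G"

lemma nonneg_concave_nonneg: "nonneg_concave G \<Longrightarrow> 0 \<le> t \<Longrightarrow> 0 \<le> G t"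
  by (simp add: nonneg_concave_def)

lemma nonneg_concave_affine_le:
  assumes "nonneg_concave G" "0 \<le> x" "x \<le> c" "c \<le> y"
    and "\<alpha> + \<beta> * x \<le> G x" "\<alpha> + \<beta> * y \<le> G y"
  shows "\<alpha> + \<beta> * c \<le> G c"
  using assms unfolding nonneg_concave_def concave_on_halfline_iff_affine by blast

lemma nonneg_concaveI:
  assumes "\<And>t. 0 \<le> t \<Longrightarrow> 0 \<le> G t"
    and "\<And>\<alpha> \<beta> x c y. \<lbrakk>0 \<le> x; x \<le> c; c \<le> y; \<alpha> + \<beta> * x \<le> G x; \<alpha> + \<beta> * y \<le> G y\<rbrakk>
           \<Longrightarrow> \<alpha> + \<beta> * c \<le> G c"
  shows "nonneg_concave G"
  using assms unfolding nonneg_concave_def concave_on_halfline_iff_affine by blast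

text \<open>A strict decrease would force negative values far out, along the extended chord.\<close>

lemma nonneg_concave_mono:
  assumes G: "nonneg_concave G" and st: "0 \<le> s" "s \<le> t"
  shows "G s \<le> G t"
proof (rule ccontr)
  assume "\<not> G s \<le> G t"
  then have less: "G t < G s" by simp
  with st have "s < t" by (cases "s = t") auto
  define \<beta> where "\<beta> = G t / (G s - G t) + 1"
  have Gt: "0 \<le> G t" using G st by (auto simp: nonneg_concave_def)
  have \<beta>: "\<beta> > 0" using less Gt by (auto simp: \<beta>_def intro: add_nonneg_pos)
  define y where "y = t + \<beta> * (t - s)"
  have y: "t < y" using \<beta> \<open>s < t\<close> by (simp add: y_def)
  \<comment> \<open>The chord through \<open>s\<close> and \<open>t\<close> is already negative at \<open>y\<close>. The line from the graph point at \<open>s\<close>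
    down to \<open>0\<close> at \<open>y\<close> lies below the graph at both ends, but above it at \<open>t\<close>.\<close>
  define b where "b = G s / (y - s)"
  have ys: "y - s = (\<beta> + 1) * (t - s)" by (simp add: y_def algebra_simps)
  have b: "b * (y - s) = G s" using y \<open>s < t\<close> by (simp add: b_def)
  have Gy: "0 \<le> G y" using G y st by (auto simp: nonneg_concave_def)
  have "(G s + b * s) + (-b) * t \<le> G t"
  proof (rule nonneg_concave_affine_le[OF G st(1) st(2)])
    show "t \<le> y" using y by simp
    show "G s + b * s + - b * s \<le> G s" by simp
    show "G s + b * s + - b * y \<le> G y" using b Gy by (simp add: algebra_simps)
  qed
  then have "G s - b * (t - s) \<le> G t" by (simp add: algebra_simps)
  then have "(G s - G t) * (\<beta> + 1) \<le> b * (t - s) * (\<beta> + 1)"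
    using \<beta> by (intro mult_right_mono) auto
  also have "\<dots> = G s" using b ys by (simp add: mult_ac)
  finally have "(G s - G t) * (\<beta> + 1) \<le> G s" .
  moreover have "(G s - G t) * (\<beta> + 1) = G t + 2 * (G s - G t)"
    using less by (simp add: \<beta>_def field_simps)
  ultimately show False using less by simp
qed

text \<open>Pasting a concave \<open>K\<close> into \<open>H\<close> from below on \<open>[a, b]\<close> keeps concavity because no change happens
  at \<open>a\<close> and \<open>b\<close>: a line below the new function at two points is below \<open>H\<close> in between, hence below
  the new function at \<open>a\<close> and \<open>b\<close> as well, and inside \<open>[a, b]\<close> the concavity of \<open>K\<close> applies.\<close>

lemma nonneg_concave_glue:
  assumes H: "nonneg_concave H" and ab: "0 \<le> a" "a \<le> b"
    and K: "\<And>\<alpha> \<beta> x c y. \<lbrakk>a \<le> x; x \<le> c; c \<le> y; y \<le> b; \<alpha> + \<beta> * x \<le> K x; \<alpha> + \<beta> * y \<le> K y\<rbrakk>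
              \<Longrightarrow> \<alpha> + \<beta> * c \<le> K c"
    and K0: "\<And>x. a \<le> x \<Longrightarrow> x \<le> b \<Longrightarrow> 0 \<le> K x"
    and KH: "H a \<le> K a" "H b \<le> K b"
  shows "nonneg_concave (\<lambda>x. if a \<le> x \<and> x \<le> b then min (H x) (K x) else H x)"
    (is "nonneg_concave ?h")
proof (rule nonneg_concaveI)
  fix t :: real assume "0 \<le> t"
  then show "0 \<le> ?h t"
    using H K0 by (auto simp: nonneg_concave_def)
next
  fix \<alpha> \<beta> x c y :: real
  assume h: "0 \<le> x" "x \<le> c" "c \<le> y" and ex: "\<alpha> + \<beta> * x \<le> ?h x" and ey: "\<alpha> + \<beta> * y \<le> ?h y"
  let ?L = "\<lambda>s. \<alpha> + \<beta> * s"
  have Hle: "?L s \<le> H s" if "x \<le> s" "s \<le> y" for s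
    using nonneg_concave_affine_le[OF H h(1) that(1) that(2), of \<alpha> \<beta>] ex ey
    by (auto split: if_splits)
  show "?L c \<le> ?h c"
  proof (cases "a \<le> c \<and> c \<le> b")
    case True
    define x' y' where "x' = max x a" and "y' = min y b"
    have xy: "a \<le> x'" "x' \<le> c" "c \<le> y'" "y' \<le> b" "x \<le> x'" "y' \<le> y"
      using True h by (auto simp: x'_def y'_def)
    have "?L x' \<le> K x'"
      using ex KH(1) Hle[of x'] xy h True by (auto simp: x'_def max_def split: if_splits)
    moreover have "?L y' \<le> K y'"
      using ey KH(2) Hle[of y'] xy h True by (auto simp: y'_def min_def split: if_splits)
    ultimately have "?L c \<le> K c" using K xy by blast
    then show ?thesis using True Hle[OF h(2,3)] by auto
  qed (use Hle h in auto)
qed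

text \<open>The Riesz decomposition property of nonnegative concave functions under the pointwise order. The
  proof is Mokobodzki's argument for superharmonic functions: the first summand \<open>H\<close> is the least
  nonnegative concave majorant of \<open>F - R\<close>. If \<open>F - H\<close> dropped below one of its chords, replacing
  \<open>H\<close> by \<open>F\<close> minus the chord there would give a smaller majorant.\<close>

lemma nonneg_concave_decomposition:
  assumes F: "nonneg_concave F" and w: "nonneg_concave w" and R: "nonneg_concave R"
    and le: "\<And>t. 0 \<le> t \<Longrightarrow> F t \<le> w t + R t"
  obtains H where "nonneg_concave H" "nonneg_concave (\<lambda>t. F t - H t)"
    "\<And>t. 0 \<le> t \<Longrightarrow> H t \<le> w t" "\<And>t. 0 \<le> t \<Longrightarrow> F t - H t \<le> R t"
proof -
  define C where "C = {h. nonneg_concave h \<and> (\<forall>t\<ge>0. F t - R t \<le> h t)}"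
  define H where "H t = (INF h\<in>C. h t)" for t
  have "F \<in> C" "w \<in> C"
    using F w R le by (fastforce simp: C_def nonneg_concave_def)+
  have bdd: "bdd_below ((\<lambda>h. h t) ` C)" if "0 \<le> t" for t
    using that by (intro bdd_belowI[of _ 0]) (auto simp: C_def nonneg_concave_def)
  have H_le: "H t \<le> h t" if "h \<in> C" "0 \<le> t" for h t
    unfolding H_def using that bdd by (intro cINF_lower) auto
  have H_ge: "z \<le> H t" if "\<And>h. h \<in> C \<Longrightarrow> z \<le> h t" for z t
    unfolding H_def using that \<open>F \<in> C\<close> by (intro cINF_greatest) auto
  have H: "nonneg_concave H"
  proof (rule nonneg_concaveI)
    show "0 \<le> H t" if "0 \<le> t" for t
      using that by (intro H_ge) (auto simp: C_def nonneg_concave_def)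
    show "\<alpha> + \<beta> * c \<le> H c"
      if "0 \<le> x" "x \<le> c" "c \<le> y" "\<alpha> + \<beta> * x \<le> H x" "\<alpha> + \<beta> * y \<le> H y" for \<alpha> \<beta> x c y
    proof (rule H_ge)
      fix h assume h: "h \<in> C"
      then show "\<alpha> + \<beta> * c \<le> h c"
        using that H_le[OF h, of x] H_le[OF h, of y]
        by (intro nonneg_concave_affine_le[of h x c y]) (auto simp: C_def)
    qed
  qed
  have HR: "F t - H t \<le> R t" if "0 \<le> t" for t
    using H_ge[of "F t - R t" t] that by (auto simp: C_def)
  have HF: "H t \<le> F t" if "0 \<le> t" for t
    using H_le[OF \<open>F \<in> C\<close> that] .
  have "nonneg_concave (\<lambda>t. F t - H t)"
  proof (rule nonneg_concaveI)
    show "0 \<le> F t - H t" if "0 \<le> t" for t using HF[OF that] by simp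
    fix \<alpha> \<beta> a c b :: real
    assume h: "0 \<le> a" "a \<le> c" "c \<le> b"
      and ea: "\<alpha> + \<beta> * a \<le> F a - H a" and eb: "\<alpha> + \<beta> * b \<le> F b - H b"
    let ?K = "\<lambda>s. F s - (\<alpha> + \<beta> * s)"
    let ?h = "\<lambda>s. if a \<le> s \<and> s \<le> b then min (H s) (?K s) else H s"
    have K0: "0 \<le> H a" "0 \<le> H b" using H h by (auto simp: nonneg_concave_def)
    \<comment> \<open>The competitor: \<open>H\<close> lowered on \<open>[a, b]\<close> to \<open>F\<close> minus the line.\<close>
    have "nonneg_concave ?h"
    proof (rule nonneg_concave_glue[OF H h(1)])
      show "a \<le> b" using h by simp
      show "\<alpha>' + \<beta>' * c' \<le> ?K c'"
        if "a \<le> x" "x \<le> c'" "c' \<le> y" "y \<le> b" "\<alpha>' + \<beta>' * x \<le> ?K x" "\<alpha>' + \<beta>' * y \<le> ?K y"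
        for \<alpha>' \<beta>' x c' y
        using nonneg_concave_affine_le[OF F, of x c' y "\<alpha> + \<alpha>'" "\<beta> + \<beta>'"] that h
        by (simp add: algebra_simps)
      show "0 \<le> ?K s" if "a \<le> s" "s \<le> b" for s
        using nonneg_concave_affine_le[OF F h(1) that, of \<alpha> \<beta>] ea eb K0 by simp
    qed (use ea eb in auto)
    moreover have "F t - R t \<le> ?h t" if "0 \<le> t" for t
    proof -
      have "\<alpha> + \<beta> * t \<le> R t" if "a \<le> t" "t \<le> b"
        using nonneg_concave_affine_le[OF R h(1) that, of \<alpha> \<beta>] ea eb HR[of a] HR[of b] h by simp
      then show ?thesis using HR[OF \<open>0 \<le> t\<close>] by auto
    qed
    ultimately have "?h \<in> C" by (simp add: C_def)
    from H_le[OF this, of c] show "\<alpha> + \<beta> * c \<le> F c - H c" using h by auto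
  qed
  with H show ?thesis using that HR H_le[OF \<open>w \<in> C\<close>] by blast
qed

lemma nonneg_concave_le_max_mult:
  assumes G: "nonneg_concave G" and t: "0 \<le> t"
  shows "G t \<le> max 1 t * G 1"
proof (cases "t \<le> 1")
  case True
  then show ?thesis using nonneg_concave_mono[OF G t True] by simp
next
  case False
  have "0 \<le> G 0" "0 \<le> G t" using G t by (auto simp: nonneg_concave_def)
  then have "0 + (G t / t) * 1 \<le> G 1"
    using False by (intro nonneg_concave_affine_le[OF G, of 0 1 t]) auto
  then show ?thesis using False by (simp add: field_simps)
qed

lemma nonneg_concave_suminf:
  assumes w: "\<And>j. nonneg_concave (w j)" and sm: "summable (\<lambda>j. w j 1)"
  shows "\<And>t. 0 \<le> t \<Longrightarrow> summable (\<lambda>j. w j t)" and "nonneg_concave (\<lambda>t. \<Sum>j. w j t)"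
proof -
  show smt: "summable (\<lambda>j. w j t)" if "0 \<le> t" for t
  proof (rule summable_comparison_test)
    show "\<exists>N. \<forall>n\<ge>N. norm (w n t) \<le> max 1 t * w n 1"
      using w that nonneg_concave_le_max_mult by (fastforce simp: nonneg_concave_def)
    show "summable (\<lambda>n. max 1 t * w n 1)" using sm by (rule summable_mult)
  qed
  show "nonneg_concave (\<lambda>t. \<Sum>j. w j t)"
    unfolding nonneg_concave_def
  proof (intro conjI allI impI)
    show "0 \<le> (\<Sum>j. w j t)" if "0 \<le> t" for t
      using w that smt by (intro suminf_nonneg) (auto simp: nonneg_concave_def)
    show "concave_on {0..} (\<lambda>t. \<Sum>j. w j t)"
      unfolding concave_on_iff
    proof (intro conjI ballI allI impI)
      fix x y u v :: real
      assume h: "x \<in> {0..}" "y \<in> {0..}" "0 \<le> u" "0 \<le> v" "u + v = 1"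
      have sx: "summable (\<lambda>j. w j x)" "summable (\<lambda>j. w j y)"
        using h smt by auto
      have "u * (\<Sum>j. w j x) + v * (\<Sum>j. w j y) = (\<Sum>j. u * w j x + v * w j y)"
        using sx by (simp add: suminf_add[symmetric] suminf_mult summable_mult)
      also have "\<dots> \<le> (\<Sum>j. w j (u *\<^sub>R x + v *\<^sub>R y))"
      proof (rule suminf_le)
        show "u * w j x + v * w j y \<le> w j (u *\<^sub>R x + v *\<^sub>R y)" for j
          using w[of j] h unfolding nonneg_concave_def concave_on_iff by blast
        show "summable (\<lambda>j. u * w j x + v * w j y)"
          using sx by (intro summable_add summable_mult)
        show "summable (\<lambda>j. w j (u *\<^sub>R x + v *\<^sub>R y))"
          using h by (intro smt) auto
      qed
      finally show "u * (\<Sum>j. w j x) + v * (\<Sum>j. w j y) \<le> (\<Sum>j. w j (u *\<^sub>R x + v *\<^sub>R y))" .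
    qed simp
  qed
qed

text \<open>Splitting off one \<open>w n\<close> at a time leaves remainders \<open>R n\<close> dominated by the tails of the series, so
  they vanish in the limit. The differences \<open>R n - R (Suc n)\<close> are the summands; working with the
  remainders means that no infinite sum of derivatives has to be formed later.\<close>

lemma nonneg_concave_countable_decomposition:
  assumes F: "nonneg_concave F" and w: "\<And>j. nonneg_concave (w j)"
    and sm: "summable (\<lambda>j. w j 1)" and le: "\<And>t. 0 \<le> t \<Longrightarrow> F t \<le> (\<Sum>j. w j t)"
  obtains R where "R 0 = F" "\<And>n. nonneg_concave (R n)"
    "\<And>n. nonneg_concave (\<lambda>t. R n t - R (Suc n) t)"
    "\<And>n t. 0 \<le> t \<Longrightarrow> R n t - R (Suc n) t \<le> w n t" "(\<lambda>n. R n 1) \<longlonglongrightarrow> 0"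
proof -
  have smt: "summable (\<lambda>j. w j t)" if "0 \<le> t" for t
    using nonneg_concave_suminf(1)[OF w sm that] .
  define W where "W n t = (\<Sum>j. w (j + n) t)" for n t
  have W: "nonneg_concave (W n)" for n
    unfolding W_def[abs_def]
    by (rule nonneg_concave_suminf(2)) (use w sm in \<open>auto intro: summable_ignore_initial_segment\<close>)
  have W_Suc: "W n t = w n t + W (Suc n) t" if "0 \<le> t" for n t
    using suminf_split_head[of "\<lambda>j. w (j + n) t"] summable_ignore_initial_segment[OF smt[OF that], of n]
    by (simp add: W_def)
  have "\<exists>R. \<forall>n. (nonneg_concave (R n) \<and> (\<forall>t\<ge>0. R n t \<le> W n t) \<and> (n = 0 \<longrightarrow> R n = F)) \<and>
      (nonneg_concave (\<lambda>t. R n t - R (Suc n) t) \<and> (\<forall>t\<ge>0. R n t - R (Suc n) t \<le> w n t))"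
  proof (rule dependent_nat_choice)
    show "\<exists>G. nonneg_concave G \<and> (\<forall>t\<ge>0. G t \<le> W 0 t) \<and> (0 = (0::nat) \<longrightarrow> G = F)"
      using F le by (auto simp: W_def)
    fix G n assume G: "nonneg_concave G \<and> (\<forall>t\<ge>0. G t \<le> W n t) \<and> (n = 0 \<longrightarrow> G = F)"
    have le': "G t \<le> w n t + W (Suc n) t" if "0 \<le> t" for t
      using G that unfolding W_Suc[OF that, of n, symmetric] by simp
    obtain H where H: "nonneg_concave H" "nonneg_concave (\<lambda>t. G t - H t)"
      "\<And>t. 0 \<le> t \<Longrightarrow> H t \<le> w n t" "\<And>t. 0 \<le> t \<Longrightarrow> G t - H t \<le> W (Suc n) t"
      using nonneg_concave_decomposition[OF conjunct1[OF G] w W le'] by blast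
    then show "\<exists>G'. (nonneg_concave G' \<and> (\<forall>t\<ge>0. G' t \<le> W (Suc n) t) \<and> (Suc n = 0 \<longrightarrow> G' = F)) \<and>
        (nonneg_concave (\<lambda>t. G t - G' t) \<and> (\<forall>t\<ge>0. G t - G' t \<le> w n t))"
      by (intro exI[of _ "\<lambda>t. G t - H t"]) simp
  qed
  then obtain R where R: "\<And>n. nonneg_concave (R n)" "\<And>n t. 0 \<le> t \<Longrightarrow> R n t \<le> W n t" "R 0 = F"
    "\<And>n. nonneg_concave (\<lambda>t. R n t - R (Suc n) t)"
    "\<And>n t. 0 \<le> t \<Longrightarrow> R n t - R (Suc n) t \<le> w n t"
    by blast
  have "(\<lambda>n. W n 1) \<longlonglongrightarrow> 0"
    unfolding W_def using sm by (rule suminf_exist_split2)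
  then have "(\<lambda>n. R n 1) \<longlonglongrightarrow> 0"
  proof (rule tendsto_sandwich[rotated 3])
    show "\<forall>\<^sub>F n in sequentially. 0 \<le> R n 1" "\<forall>\<^sub>F n in sequentially. R n 1 \<le> W n 1"
      using R by (auto simp: nonneg_concave_def)
  qed auto
  with R show ?thesis using that by blast
qed


section \<open>Slopes\<close>

text \<open>For concave \<open>G\<close> and finite \<open>\<tau> > 0\<close> this is the left derivative at \<open>\<tau>\<close>. At \<open>0\<close> the infimum is empty and
  gives \<open>\<infinity>\<close>; at \<open>\<infinity>\<close> it gives the limit of the derivatives. Points of a space of infinite
  measure can sit at position \<open>\<infinity>\<close>, which is why the argument is extended.\<close>

definition left_slope :: "(real \<Rightarrow> real) \<Rightarrow> ennreal \<Rightarrow> ennreal" where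
  "left_slope G \<tau> =
     (INF (s, r)\<in>{(s, r). 0 \<le> s \<and> s < r \<and> ennreal r \<le> \<tau>}. ennreal ((G r - G s) / (r - s)))"

lemma left_slope_antimono: "\<tau> \<le> \<tau>' \<Longrightarrow> left_slope G \<tau>' \<le> left_slope G \<tau>"
  unfolding left_slope_def by (rule INF_superset_mono) auto

lemma left_slope_le:
  "0 \<le> s \<Longrightarrow> s < r \<Longrightarrow> ennreal r \<le> \<tau> \<Longrightarrow> left_slope G \<tau> \<le> ennreal ((G r - G s) / (r - s))"
  unfolding left_slope_def by (rule INF_lower2[of "(s, r)"]) auto

lemma left_slope_finite: "0 < \<tau> \<Longrightarrow> left_slope G \<tau> < \<infinity>"
proof -
  assume "0 < \<tau>"
  then obtain r where "0 < r" "ennreal r \<le> \<tau>"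
    by (cases \<tau>) (auto intro: that[of 1] that)
  then have "left_slope G \<tau> \<le> ennreal ((G r - G 0) / (r - 0))"
    by (intro left_slope_le) auto
  then show ?thesis by (auto intro: le_less_trans)
qed

lemma le_left_slopeI:
  assumes "\<And>s r. 0 \<le> s \<Longrightarrow> s < r \<Longrightarrow> ennreal r \<le> \<tau> \<Longrightarrow> z \<le> ennreal ((G r - G s) / (r - s))"
  shows "z \<le> left_slope G \<tau>"
  unfolding left_slope_def using assms by (intro INF_greatest) auto

lemma nonneg_concave_slope_antimono:
  assumes G: "nonneg_concave G" and h: "0 \<le> s" "s < r" "s \<le> s'" "r \<le> r'" "s' < r'"
  shows "(G r' - G s') / (r' - s') \<le> (G r - G s) / (r - s)"
proof -
  \<comment> \<open>The chord from \<open>s\<close> to \<open>r'\<close> has a slope \<open>\<gamma>\<close> between the two.\<close>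
  define \<beta> \<beta>' \<gamma> where "\<beta> = (G r - G s) / (r - s)" and "\<beta>' = (G r' - G s') / (r' - s')"
    and "\<gamma> = (G r' - G s) / (r' - s)"
  have eq: "\<beta> * (r - s) = G r - G s" "\<beta>' * (r' - s') = G r' - G s'" "\<gamma> * (r' - s) = G r' - G s"
    using h by (simp_all add: \<beta>_def \<beta>'_def \<gamma>_def)
  have chord: "(G s - \<gamma> * s) + \<gamma> * c \<le> G c" if "s \<le> c" "c \<le> r'" for c
    using that h eq(3) by (intro nonneg_concave_affine_le[OF G, of s c r']) (auto simp: algebra_simps)
  have "\<gamma> * (r - s) \<le> \<beta> * (r - s)" using chord[of r] h eq by (simp add: algebra_simps)
  moreover have "\<beta>' * (r' - s') \<le> \<gamma> * (r' - s')" using chord[of s'] h eq by (simp add: algebra_simps)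
  ultimately have "\<beta>' \<le> \<beta>" using h by simp
  then show ?thesis unfolding \<beta>_def \<beta>'_def .
qed

text \<open>The slopes entering the infimum are directed downwards, so the infimum of sums is the sum of
  infima.\<close>

lemma left_slope_add:
  assumes G: "nonneg_concave G" and H: "nonneg_concave H" and F: "\<And>t. 0 \<le> t \<Longrightarrow> F t = G t + H t"
  shows "left_slope F \<tau> = left_slope G \<tau> + left_slope H \<tau>"
proof (rule antisym)
  have nn: "0 \<le> (K r - K s) / (r - s)" if "nonneg_concave K" "0 \<le> s" "s < r" for K s r
    using nonneg_concave_mono[OF that(1,2), of r] that by simp
  have split: "ennreal ((F r - F s) / (r - s)) =
      ennreal ((G r - G s) / (r - s)) + ennreal ((H r - H s) / (r - s))"
    if "0 \<le> s" "s < r" for s r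
    using that nn[OF G that] nn[OF H that]
    by (subst ennreal_plus[symmetric]) (auto simp: F add_divide_distrib[symmetric] algebra_simps)
  show "left_slope G \<tau> + left_slope H \<tau> \<le> left_slope F \<tau>"
    by (rule le_left_slopeI) (auto simp: split intro!: add_mono left_slope_le)
  have *: "left_slope F \<tau> \<le> ennreal ((G r - G s) / (r - s)) + ennreal ((H r' - H s') / (r' - s'))"
    if h: "0 \<le> s" "s < r" "ennreal r \<le> \<tau>" "0 \<le> s'" "s' < r'" "ennreal r' \<le> \<tau>" for s r s' r'
  proof -
    let ?s = "max s s'" and ?r = "max r r'"
    have m: "0 \<le> ?s" "?s < ?r" "ennreal ?r \<le> \<tau>" using h by (auto simp: max_def)
    have "left_slope F \<tau> \<le> ennreal ((F ?r - F ?s) / (?r - ?s))"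
      using m by (rule left_slope_le)
    also have "\<dots> = ennreal ((G ?r - G ?s) / (?r - ?s)) + ennreal ((H ?r - H ?s) / (?r - ?s))"
      using m by (intro split)
    also have "\<dots> \<le> ennreal ((G r - G s) / (r - s)) + ennreal ((H r' - H s') / (r' - s'))"
      using h m by (intro add_mono ennreal_leI nonneg_concave_slope_antimono G H) auto
    finally show ?thesis .
  qed
  show "left_slope F \<tau> \<le> left_slope G \<tau> + left_slope H \<tau>"
  proof (cases "\<tau> = 0")
    case True
    then have "left_slope G \<tau> = top"
      unfolding left_slope_def by (auto simp: top_unique intro!: Inf_eqI)
    then show ?thesis by simp
  next
    case False
    let ?P = "{(s, r). 0 \<le> s \<and> s < r \<and> ennreal r \<le> \<tau>}"
    have ne: "?P \<noteq> {}"
    proof -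
      obtain r where "0 < r" "ennreal r \<le> \<tau>"
        using False by (cases \<tau>) (auto simp: less_le intro: that[of 1] that)
      then have "(0, r) \<in> ?P" by simp
      then show ?thesis by blast
    qed
    obtain g where g: "range g \<subseteq> (\<lambda>(s, r). ennreal ((G r - G s) / (r - s))) ` ?P"
        "left_slope G \<tau> = (INF i::nat. g i)"
      using ennreal_Inf_countable_INF[of "(\<lambda>(s, r). ennreal ((G r - G s) / (r - s))) ` ?P"] ne
      unfolding left_slope_def by auto
    obtain h where h: "range h \<subseteq> (\<lambda>(s, r). ennreal ((H r - H s) / (r - s))) ` ?P"
        "left_slope H \<tau> = (INF i::nat. h i)"
      using ennreal_Inf_countable_INF[of "(\<lambda>(s, r). ennreal ((H r - H s) / (r - s))) ` ?P"] ne
      unfolding left_slope_def by auto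
    have "left_slope F \<tau> \<le> g i + h j" for i j
    proof -
      obtain s r where 1: "0 \<le> s" "s < r" "ennreal r \<le> \<tau>" "g i = ennreal ((G r - G s) / (r - s))"
        using subsetD[OF g(1) rangeI[of g i]] by auto
      obtain s' r' where 2: "0 \<le> s'" "s' < r'" "ennreal r' \<le> \<tau>" "h j = ennreal ((H r' - H s') / (r' - s'))"
        using subsetD[OF h(1) rangeI[of h j]] by auto
      show ?thesis unfolding 1(4) 2(4) by (rule *[OF 1(1-3) 2(1-3)])
    qed
    then show ?thesis
      unfolding g(2) h(2) INF_ennreal_add_const[symmetric] INF_ennreal_const_add[symmetric]
      by (intro INF_greatest)
  qed
qed

lemma nonneg_concave_tangent:
  assumes G: "nonneg_concave G" and t: "0 < t" and z: "left_slope G (ennreal t) = ennreal z" "0 \<le> z"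
    and s: "0 \<le> s"
  shows "G s \<le> G t + z * (s - t)"
proof (cases s t rule: linorder_cases)
  case less
  have "ennreal z \<le> ennreal ((G t - G s) / (t - s))"
    unfolding z(1)[symmetric] using s less by (intro left_slope_le) auto
  then have "z \<le> (G t - G s) / (t - s)"
    using nonneg_concave_mono[OF G s, of t] less by (subst (asm) ennreal_le_iff) auto
  then show ?thesis using less by (simp add: field_simps)
next
  case greater
  have "ennreal ((G s - G t) / (s - t)) \<le> left_slope G (ennreal t)"
    using greater t by (intro le_left_slopeI ennreal_leI nonneg_concave_slope_antimono G) auto
  then have "(G s - G t) / (s - t) \<le> z" unfolding z(1) using z(2) by simp
  then show ?thesis using greater by (simp add: field_simps)
qed simp

section \<open>Integrals of slopes\<close>

lemma borel_measurable_mono_ennreal: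
  fixes f :: "ennreal \<Rightarrow> ennreal"
  assumes "mono f"
  shows "f \<in> borel_measurable borel"
proof (rule borel_measurableI_greater)
  fix c
  let ?I = "{x. c < f x}"
  have up: "y \<in> ?I" if "x \<in> ?I" "x \<le> y" for x y
    using that monoD[OF assms, of x y] by auto
  have "?I = {Inf ?I..} \<or> ?I = {Inf ?I<..}"
  proof (cases "Inf ?I \<in> ?I")
    case True
    have "?I = {Inf ?I..}" using up[OF True] by (auto intro: Inf_lower)
    then show ?thesis ..
  next
    case False
    have "?I = {Inf ?I<..}"
    proof (intro set_eqI iffI)
      show "x \<in> {Inf ?I<..}" if "x \<in> ?I" for x
        using that False Inf_lower[OF that] by (auto simp: less_le)
      show "x \<in> ?I" if "x \<in> {Inf ?I<..}" for x
        using that up unfolding greaterThan_iff Inf_less_iff by (blast intro: less_imp_le)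
    qed
    then show ?thesis ..
  qed
  then have "?I \<in> sets borel" by (metis borel_closed borel_open closed_atLeast open_greaterThan)
  then show "{x \<in> space borel. c < f x} \<in> sets borel" by simp
qed

lemma borel_measurable_antimono_ennreal:
  fixes f :: "ennreal \<Rightarrow> ennreal"
  assumes "antimono f"
  shows "f \<in> borel_measurable borel"
proof (rule borel_measurableI_greater)
  fix c
  let ?I = "{x. c < f x}"
  have down: "x \<in> ?I" if "y \<in> ?I" "x \<le> y" for x y
    using that antimonoD[OF assms, of x y] by auto
  have "?I = {..Sup ?I} \<or> ?I = {..<Sup ?I}"
  proof (cases "Sup ?I \<in> ?I")
    case True
    have "?I = {..Sup ?I}" using down[OF True] by (auto intro: Sup_upper)
    then show ?thesis ..
  next
    case False
    have "?I = {..<Sup ?I}"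
    proof (intro set_eqI iffI)
      show "x \<in> {..<Sup ?I}" if "x \<in> ?I" for x
        using that False Sup_upper[OF that] by (auto simp: less_le)
      show "x \<in> ?I" if "x \<in> {..<Sup ?I}" for x
        using that down unfolding lessThan_iff less_Sup_iff by (blast intro: less_imp_le)
    qed
    then show ?thesis ..
  qed
  then have "?I \<in> sets borel" by (metis borel_closed borel_open closed_atMost open_lessThan)
  then show "{x \<in> space borel. c < f x} \<in> sets borel" by simp
qed

lemma left_slope_measurable:
  "(\<lambda>\<tau>. left_slope G (ennreal \<tau>)) \<in> borel_measurable borel"
proof -
  have "left_slope G \<in> borel_measurable borel"
    by (intro borel_measurable_antimono_ennreal antimonoI left_slope_antimono)
  from measurable_compose[OF measurable_ennreal this] show ?thesis .
qed

text \<open>The easy half of the fundamental theorem of calculus. On a grid of mesh \<open>h\<close> the left slope in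
  one cell is at most the difference quotient over the preceding cell, and these telescope; the
  first cell is lost, and it shrinks away as the mesh is refined.\<close>

lemma nn_integral_left_slope_le:
  assumes G: "nonneg_concave G" and m: "0 < m"
  shows "(\<integral>\<^sup>+\<tau>. left_slope G (ennreal \<tau>) * indicator {0<..m} \<tau> \<partial>lborel) \<le> ennreal (G m)"
proof -
  note left_slope_measurable[measurable]
  have part: "(\<integral>\<^sup>+\<tau>. left_slope G (ennreal \<tau>) * indicator {h<..real (Suc k) * h} \<tau> \<partial>lborel)
      \<le> ennreal (G (real k * h))" if h: "0 < h" for h k
  proof (induction k)
    case 0
    show ?case by simp
  next
    case (Suc k)
    have split: "indicator {h<..c} \<tau> = (indicator {h<..b} \<tau> + indicator {b<..c} \<tau> :: ennreal)"
      if "h \<le> b" "b \<le> c" for b c \<tau>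
      using that by (auto simp: indicator_def)
    define a b c where "a = real k * h" and "b = real (Suc k) * h" and "c = real (Suc (Suc k)) * h"
    have ab: "0 \<le> a" "a < b" "b < c" "b - a = h" "c - b = h" "h \<le> b"
      using h by (auto simp: a_def b_def c_def algebra_simps)
    have Gab: "G a \<le> G b" "0 \<le> G a"
      using nonneg_concave_mono[OF G ab(1), of b] nonneg_concave_nonneg[OF G ab(1)] ab(2) by simp_all
    have "(\<integral>\<^sup>+\<tau>. left_slope G (ennreal \<tau>) * indicator {h<..c} \<tau> \<partial>lborel)
        = (\<integral>\<^sup>+\<tau>. left_slope G (ennreal \<tau>) * indicator {h<..b} \<tau>
             + left_slope G (ennreal \<tau>) * indicator {b<..c} \<tau> \<partial>lborel)"
      by (simp only: split[OF ab(6) less_imp_le[OF ab(3)]] distrib_left)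
    also have "\<dots> = (\<integral>\<^sup>+\<tau>. left_slope G (ennreal \<tau>) * indicator {h<..b} \<tau> \<partial>lborel)
        + (\<integral>\<^sup>+\<tau>. left_slope G (ennreal \<tau>) * indicator {b<..c} \<tau> \<partial>lborel)"
      by (intro nn_integral_add) auto
    also have "(\<integral>\<^sup>+\<tau>. left_slope G (ennreal \<tau>) * indicator {b<..c} \<tau> \<partial>lborel)
        \<le> (\<integral>\<^sup>+\<tau>. ennreal ((G b - G a) / h) * indicator {b<..c} \<tau> \<partial>lborel)"
    proof (intro nn_integral_mono)
      fix \<tau>
      have "left_slope G (ennreal \<tau>) \<le> ennreal ((G b - G a) / (b - a))" if "b < \<tau>"
        using ab that by (intro left_slope_le ennreal_leI) auto
      then show "left_slope G (ennreal \<tau>) * indicator {b<..c} \<tau>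
          \<le> ennreal ((G b - G a) / h) * indicator {b<..c} \<tau>"
        using ab(4) by (auto simp: indicator_def)
    qed
    also have "\<dots> = ennreal ((G b - G a) / h) * ennreal h"
      using ab by (simp add: nn_integral_cmult_indicator)
    also have "\<dots> = ennreal (G b - G a)"
      using h Gab by (simp add: ennreal_mult[symmetric])
    also have "(\<integral>\<^sup>+\<tau>. left_slope G (ennreal \<tau>) * indicator {h<..b} \<tau> \<partial>lborel) \<le> ennreal (G a)"
      unfolding a_def b_def by (rule Suc.IH)
    also have "ennreal (G a) + ennreal (G b - G a) = ennreal (G b)"
      using Gab by (simp add: ennreal_plus[symmetric] del: ennreal_plus)
    finally show ?case by (simp add: add_mono b_def[symmetric] c_def[symmetric] del: of_nat_Suc)
  qed
  let ?f = "\<lambda>n \<tau>. left_slope G (ennreal \<tau>) * indicator {m / real (Suc n)<..m} \<tau>"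
  have "(\<integral>\<^sup>+\<tau>. left_slope G (ennreal \<tau>) * indicator {0<..m} \<tau> \<partial>lborel) = (\<integral>\<^sup>+\<tau>. (SUP n. ?f n \<tau>) \<partial>lborel)"
  proof (intro nn_integral_cong)
    fix \<tau> :: real
    show "left_slope G (ennreal \<tau>) * indicator {0<..m} \<tau> = (SUP n. ?f n \<tau>)"
    proof (cases "\<tau> \<in> {0<..m}")
      case True
      then obtain n where "m / real (Suc n) < \<tau>"
        using reals_Archimedean[of "\<tau> / m"] m by (auto simp: field_simps)
      then have "left_slope G (ennreal \<tau>) * indicator {0<..m} \<tau> \<le> ?f n \<tau>"
        using True by simp
      then show ?thesis
        using True by (intro antisym SUP_upper2[of n] SUP_least) (auto simp: indicator_def)
    next
      case False
      have zero: "?f n \<tau> = 0" for n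
      proof -
        have "0 < m / real (Suc n)" using m by simp
        then have "\<tau> \<notin> {m / real (Suc n)<..m}"
          using False unfolding greaterThanAtMost_iff by linarith
        then show ?thesis by (simp del: of_nat_Suc)
      qed
      show ?thesis unfolding zero using False by simp
    qed
  qed
  also have "\<dots> = (SUP n. integral\<^sup>N lborel (?f n))"
  proof (intro nn_integral_monotone_convergence_SUP incseq_SucI le_funI)
    fix n \<tau>
    have "m / real (Suc (Suc n)) \<le> m / real (Suc n)"
      using m by (intro divide_left_mono) auto
    then show "?f n \<tau> \<le> ?f (Suc n) \<tau>" by (auto simp: indicator_def)
  qed simp
  also have "\<dots> \<le> ennreal (G m)"
  proof (rule SUP_least)
    fix n
    let ?h = "m / real (Suc n)"
    have "integral\<^sup>N lborel (?f n) \<le> ennreal (G (real n * ?h))"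
      using part[of ?h n] m by simp
    also have "\<dots> \<le> ennreal (G m)"
      using m by (intro ennreal_leI nonneg_concave_mono[OF G]) (auto simp: field_simps)
    finally show "integral\<^sup>N lborel (?f n) \<le> ennreal (G m)" .
  qed
  finally show ?thesis .
qed

text \<open>The hypothesis says that the line of slope \<open>z\<close> and height \<open>C\<close> at \<open>0\<close> is above \<open>G\<close>. The left slope
  exceeds \<open>z\<close> on an initial interval, and up to any point \<open>m\<close> of it the integral is at most
  \<open>G m - m * z\<close>.\<close>

lemma nn_integral_left_slope_excess_le:
  assumes G: "nonneg_concave G" and z: "0 \<le> z" and C: "\<And>s. 0 \<le> s \<Longrightarrow> G s \<le> C + s * z"
  shows "(\<integral>\<^sup>+\<tau>. (left_slope G (ennreal \<tau>) - ennreal z) * indicator {0<..} \<tau> \<partial>lborel) \<le> ennreal C"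
proof -
  note left_slope_measurable[measurable]
  let ?D = "\<lambda>\<tau>. left_slope G (ennreal \<tau>)"
  have C0: "0 \<le> C" using C[of 0] nonneg_concave_nonneg[OF G, of 0] by simp
  have above: "(\<integral>\<^sup>+\<tau>. (?D \<tau> - ennreal z) * indicator {0<..m} \<tau> \<partial>lborel) \<le> ennreal C"
    if m: "0 < m" and D: "\<And>\<tau>. 0 < \<tau> \<Longrightarrow> \<tau> < m \<Longrightarrow> ennreal z \<le> ?D \<tau>" for m
  proof -
    have "(\<integral>\<^sup>+\<tau>. (?D \<tau> - ennreal z) * indicator {0<..m} \<tau> \<partial>lborel) + ennreal (m * z)
        = (\<integral>\<^sup>+\<tau>. (?D \<tau> - ennreal z) * indicator {0<..m} \<tau> \<partial>lborel)
          + (\<integral>\<^sup>+\<tau>. ennreal z * indicator {0<..m} \<tau> \<partial>lborel)"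
      using m z by (simp add: nn_integral_cmult_indicator ennreal_mult mult.commute)
    also have "\<dots> = (\<integral>\<^sup>+\<tau>. (?D \<tau> - ennreal z) * indicator {0<..m} \<tau> + ennreal z * indicator {0<..m} \<tau> \<partial>lborel)"
      by (intro nn_integral_add[symmetric]) auto
    also have "\<dots> = (\<integral>\<^sup>+\<tau>. ?D \<tau> * indicator {0<..m} \<tau> \<partial>lborel)"
    proof (rule nn_integral_cong_AE)
      show "AE \<tau> in lborel. (?D \<tau> - ennreal z) * indicator {0<..m} \<tau> + ennreal z * indicator {0<..m} \<tau>
          = ?D \<tau> * indicator {0<..m} \<tau>"
        using AE_lborel_singleton[of m]
        by eventually_elim (use D in \<open>auto simp: indicator_def diff_add_cancel_ennreal\<close>)
    qed
    also have "\<dots> \<le> ennreal (G m)" by (rule nn_integral_left_slope_le[OF G m])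
    also have "\<dots> \<le> ennreal (C + m * z)" using C m by (intro ennreal_leI) auto
    also have "\<dots> = ennreal C + ennreal (m * z)" using C0 m z by simp
    finally show ?thesis by simp
  qed
  show ?thesis
  proof (cases "\<forall>\<tau>>0. ennreal z < ?D \<tau>")
    case True
    let ?f = "\<lambda>n \<tau>. (?D \<tau> - ennreal z) * indicator {0<..real (Suc n)} \<tau>"
    have "(\<integral>\<^sup>+\<tau>. (?D \<tau> - ennreal z) * indicator {0<..} \<tau> \<partial>lborel) = (\<integral>\<^sup>+\<tau>. (SUP n. ?f n \<tau>) \<partial>lborel)"
    proof (intro nn_integral_cong)
      fix \<tau> :: real
      obtain n where "\<tau> \<le> real n" using real_arch_simple by blast
      then have "(?D \<tau> - ennreal z) * indicator {0<..} \<tau> \<le> ?f n \<tau>"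
        by (auto simp: indicator_def)
      then show "(?D \<tau> - ennreal z) * indicator {0<..} \<tau> = (SUP n. ?f n \<tau>)"
        by (intro antisym SUP_upper2[of n] SUP_least) (auto simp: indicator_def)
    qed
    also have "\<dots> = (SUP n. integral\<^sup>N lborel (?f n))"
      by (intro nn_integral_monotone_convergence_SUP incseq_SucI le_funI) (auto simp: indicator_def)
    also have "\<dots> \<le> ennreal C"
      using True by (intro SUP_least above) (auto intro: less_imp_le)
    finally show ?thesis .
  next
    case False
    define m where "m = Inf {\<tau>. 0 < \<tau> \<and> ?D \<tau> \<le> ennreal z}"
    have ne: "{\<tau>. 0 < \<tau> \<and> ?D \<tau> \<le> ennreal z} \<noteq> {}" using False by (force simp: not_less)
    have bdd: "bdd_below {\<tau>. 0 < \<tau> \<and> ?D \<tau> \<le> ennreal z}" by (auto intro!: bdd_belowI[of _ 0])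
    have m0: "0 \<le> m" unfolding m_def using ne by (intro cInf_greatest) auto
    have small: "?D \<tau> \<le> ennreal z" if "m < \<tau>" for \<tau>
    proof -
      have "Inf {\<tau>. 0 < \<tau> \<and> ?D \<tau> \<le> ennreal z} < \<tau>"
        using that unfolding m_def .
      then obtain \<tau>' where "0 < \<tau>'" "?D \<tau>' \<le> ennreal z" "\<tau>' < \<tau>"
        using cInf_lessD[OF ne] by blast
      then show ?thesis
        using left_slope_antimono[of "ennreal \<tau>'" "ennreal \<tau>" G] by (auto intro: order_trans ennreal_leI)
    qed
    have "(\<integral>\<^sup>+\<tau>. (?D \<tau> - ennreal z) * indicator {0<..} \<tau> \<partial>lborel)
        = (\<integral>\<^sup>+\<tau>. (?D \<tau> - ennreal z) * indicator {0<..m} \<tau> \<partial>lborel)"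
      using small by (intro nn_integral_cong) (auto simp: indicator_def diff_eq_0_iff_ennreal not_le intro: le_less_trans[OF small])
    also have "\<dots> \<le> ennreal C"
    proof (cases "m = 0")
      case False
      show ?thesis
      proof (rule above)
        show "0 < m" using m0 False by simp
        show "ennreal z \<le> ?D \<tau>" if "0 < \<tau>" "\<tau> < m" for \<tau>
          using that cInf_lower[OF _ bdd, of \<tau>] unfolding m_def by fastforce
      qed
    qed simp
    finally show ?thesis .
  qed
qed

section \<open>Superlevel sets\<close>

lemma nn_integral_layer_cake:
  assumes "sigma_finite_measure M" and f[measurable]: "f \<in> borel_measurable M"
  shows "(\<integral>\<^sup>+x. f x \<partial>M) =
    (\<integral>\<^sup>+y. emeasure M {x\<in>space M. ennreal y < f x} * indicator {0<..} y \<partial>lborel)"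
proof -
  interpret sigma_finite_measure M by fact
  interpret pair_sigma_finite M lborel by standard
  have c: "c = (\<integral>\<^sup>+y. indicator {y. 0 < y \<and> ennreal y < c} y \<partial>lborel)" for c :: ennreal
  proof (cases c)
    case (real r)
    then have "{y. 0 < y \<and> ennreal y < c} = {0<..<r}" by (auto simp: ennreal_less_iff)
    with real show ?thesis by simp
  next
    case top
    then have "{y. 0 < y \<and> ennreal y < c} = {0<..}" by auto
    moreover have "emeasure lborel {0::real<..} = \<infinity>"
    proof -
      have "ennreal (real n) \<le> emeasure lborel {0::real<..}" for n
      proof -
        have "ennreal (real n) = emeasure lborel {0<..<real n}" by simp
        also have "\<dots> \<le> emeasure lborel {0::real<..}" by (intro emeasure_mono) auto
        finally show ?thesis .
      qed
      then have "\<not> emeasure lborel {0::real<..} < top"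
        using ennreal_Ex_less_of_nat[of "emeasure lborel {0::real<..}"]
        by (auto simp: ennreal_of_nat_eq_real_of_nat not_less[symmetric])
      then show ?thesis by (metis infinity_ennreal_def less_top)
    qed
    ultimately show ?thesis using top by simp
  qed
  have "(\<integral>\<^sup>+x. f x \<partial>M) = (\<integral>\<^sup>+x. \<integral>\<^sup>+y. indicator {p\<in>space (M \<Otimes>\<^sub>M lborel). 0 < snd p \<and> ennreal (snd p) < f (fst p)} (x, y) \<partial>lborel \<partial>M)"
  proof (rule nn_integral_cong)
    fix x assume x: "x \<in> space M"
    show "f x = (\<integral>\<^sup>+y. indicator {p\<in>space (M \<Otimes>\<^sub>M lborel). 0 < snd p \<and> ennreal (snd p) < f (fst p)} (x, y) \<partial>lborel)"
      by (rule trans[OF c], intro nn_integral_cong) (auto simp: space_pair_measure indicator_def x)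
  qed
  also have "\<dots> = (\<integral>\<^sup>+y. \<integral>\<^sup>+x. indicator {p\<in>space (M \<Otimes>\<^sub>M lborel). 0 < snd p \<and> ennreal (snd p) < f (fst p)} (x, y) \<partial>M \<partial>lborel)"
    by (intro Fubini'[symmetric]) measurable
  also have "\<dots> = (\<integral>\<^sup>+y. \<integral>\<^sup>+x. indicator {x\<in>space M. ennreal y < f x} x * indicator {0<..} y \<partial>M \<partial>lborel)"
    by (intro nn_integral_cong) (auto simp: space_pair_measure indicator_def)
  also have "\<dots> = (\<integral>\<^sup>+y. emeasure M {x\<in>space M. ennreal y < f x} * indicator {0<..} y \<partial>lborel)"
    by (intro nn_integral_cong) (auto simp: nn_integral_multc)
  finally show ?thesis .
qed

text \<open>A position function that fills mass no faster than Lebesgue measure does turns a decreasing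
  profile into a function that is smaller in distribution.\<close>

lemma nn_integral_antimono_position_le:
  fixes \<phi> :: "ennreal \<Rightarrow> ennreal" and p :: "'a \<Rightarrow> ennreal"
  assumes M: "sigma_finite_measure M" and p[measurable]: "p \<in> borel_measurable M"
    and pos: "\<And>\<tau>. emeasure M {x\<in>space M. p x \<le> \<tau>} \<le> \<tau>" and \<phi>: "antimono \<phi>"
  shows "(\<integral>\<^sup>+x. \<phi> (p x) \<partial>M) \<le> (\<integral>\<^sup>+\<tau>. \<phi> (ennreal \<tau>) * indicator {0<..} \<tau> \<partial>lborel)"
proof -
  have \<phi>_meas[measurable]: "\<phi> \<in> borel_measurable borel"
    using \<phi> by (rule borel_measurable_antimono_ennreal)
  have lb: "sigma_finite_measure (lborel :: real measure)" by (rule sigma_finite_lborel)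
  show ?thesis
    unfolding nn_integral_layer_cake[OF M measurable_compose[OF p \<phi>_meas]]
  proof (subst (2) nn_integral_layer_cake[OF lb], simp, intro nn_integral_mono mult_right_mono)
    fix y :: real
    let ?S = "{\<tau> \<in> space lborel. ennreal y < \<phi> (ennreal \<tau>) * indicator {0<..} \<tau>}"
    let ?m = "emeasure lborel ?S"
    \<comment> \<open>The superlevel set of the profile is an interval starting at \<open>0\<close>; its length bounds every
      position at which the profile exceeds \<open>y\<close>.\<close>
    have "p x \<le> ?m" if "ennreal y < \<phi> (p x)" for x
    proof (rule dense_le)
      fix w assume "w < p x"
      then obtain r where r: "w = ennreal r" "0 \<le> r" by (cases w) auto
      have "{0<..<r} \<subseteq> ?S"
      proof
        fix \<tau> assume "\<tau> \<in> {0<..<r}"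
        moreover from this have "ennreal \<tau> \<le> p x"
          using \<open>w < p x\<close> r by (auto intro: order_trans[OF _ less_imp_le] ennreal_leI)
        ultimately show "\<tau> \<in> ?S"
          using that antimonoD[OF \<phi>, of "ennreal \<tau>" "p x"] by auto
      qed
      then have "emeasure lborel {0<..<r} \<le> ?m" by (intro emeasure_mono) measurable
      then show "w \<le> ?m" using r by simp
    qed
    then have "emeasure M {x \<in> space M. ennreal y < \<phi> (p x)} \<le> emeasure M {x\<in>space M. p x \<le> ?m}"
      by (intro emeasure_mono) auto
    also have "\<dots> \<le> ?m" by (rule pos)
    finally show "emeasure M {x \<in> space M. ennreal y < \<phi> (p x)} \<le> ?m" .
  qed simp
qed

definition superlevel_mass :: "'a measure \<Rightarrow> ('a \<Rightarrow> ennreal) \<Rightarrow> ennreal \<Rightarrow> ennreal" where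
  "superlevel_mass M f y = emeasure M {u\<in>space M. y \<le> f u}"

lemma superlevel_mass_antimono:
  assumes [measurable]: "f \<in> borel_measurable M"
  shows "antimono (superlevel_mass M f)"
  unfolding superlevel_mass_def by (intro antimonoI emeasure_mono) (auto intro: order_trans)

lemma superlevel_mass_measurable:
  assumes f: "f \<in> borel_measurable M"
  shows "superlevel_mass M f \<in> borel_measurable borel"
  using superlevel_mass_antimono[OF f] by (rule borel_measurable_antimono_ennreal)

text \<open>The points of mass position at most \<open>\<tau>\<close> form a superlevel set of \<open>f\<close>, closed or open; in the
  open case it is an increasing union of closed ones.\<close>

lemma emeasure_superlevel_mass_le:
  assumes f[measurable]: "f \<in> borel_measurable M"
  shows "emeasure M {x\<in>space M. superlevel_mass M f (f x) \<le> \<tau>} \<le> \<tau>"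
proof -
  let ?I = "{y. superlevel_mass M f y \<le> \<tau>}"
  have up: "y' \<in> ?I" if "y \<in> ?I" "y \<le> y'" for y y'
    using that antimonoD[OF superlevel_mass_antimono[OF f], of y y'] by auto
  show ?thesis
  proof (cases "?I = {}")
    case True
    then have none: "{x\<in>space M. superlevel_mass M f (f x) \<le> \<tau>} = {}" by auto
    show ?thesis unfolding none by simp
  next
    case False
    then obtain g :: "nat \<Rightarrow> ennreal" where g: "decseq g" "range g \<subseteq> ?I" "Inf ?I = (INF i. g i)"
      using ennreal_Inf_countable_INF[OF False] by auto
    show ?thesis
    proof (cases "Inf ?I \<in> ?I")
      case True
      have "emeasure M {x\<in>space M. superlevel_mass M f (f x) \<le> \<tau>} \<le> superlevel_mass M f (Inf ?I)"
        unfolding superlevel_mass_def[of M f "Inf ?I"] by (intro emeasure_mono) (auto intro: Inf_lower)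
      then show ?thesis using True by auto
    next
      case notin: False
      have "{x\<in>space M. superlevel_mass M f (f x) \<le> \<tau>} \<subseteq> (\<Union>i. {x\<in>space M. g i \<le> f x})"
      proof
        fix x assume x: "x \<in> {x\<in>space M. superlevel_mass M f (f x) \<le> \<tau>}"
        then have "Inf ?I < f x" using notin by (auto simp: less_le intro: Inf_lower)
        then obtain i where "g i < f x" unfolding g(3) by (auto simp: INF_less_iff)
        then show "x \<in> (\<Union>i. {x\<in>space M. g i \<le> f x})" using x by (auto intro: less_imp_le)
      qed
      then have "emeasure M {x\<in>space M. superlevel_mass M f (f x) \<le> \<tau>}
          \<le> emeasure M (\<Union>i. {x\<in>space M. g i \<le> f x})"
        by (intro emeasure_mono) auto
      also have "\<dots> = (SUP i. emeasure M {x\<in>space M. g i \<le> f x})"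
        using g(1) by (intro SUP_emeasure_incseq[symmetric])
          (auto simp: incseq_def decseq_def intro: order_trans)
      also have "\<dots> \<le> \<tau>"
        using g(2) by (intro SUP_least) (auto simp: superlevel_mass_def)
      finally show ?thesis .
    qed
  qed
qed

section \<open>Core decreasing functions and their least majorants\<close>

lemma inverse_le_inverse_iff_ennreal: "inverse a \<le> inverse b \<longleftrightarrow> b \<le> (a :: ennreal)"
proof (cases a)
  case a: (real r)
  show ?thesis
  proof (cases b)
    case b: (real q)
    show ?thesis
      using a b by (cases "r = 0"; cases "q = 0") (auto simp: inverse_ennreal top_unique)
  qed (use a in \<open>simp add: top_unique\<close>)
qed simp

locale full_core_space = sigma_finite_measure M for M :: "'a measure" +
  fixes \<A> :: "'a set set"
  assumes full: "full_ordered_core M \<A>"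
begin

lemma core_sets: "\<A> \<subseteq> sets M" "\<A> \<subseteq> Pow (space M)"
proof -
  show "\<A> \<subseteq> sets M" using full by (simp add: full_ordered_core_def ordered_core_def)
  then show "\<A> \<subseteq> Pow (space M)" using sets.space_closed[of M] by blast
qed

lemma core_total: "A \<in> \<A> \<Longrightarrow> B \<in> \<A> \<Longrightarrow> A \<subseteq> B \<or> B \<subseteq> A"
  using full unfolding full_ordered_core_def ordered_core_def by simp

lemma core_finite: "A \<in> \<A> \<Longrightarrow> emeasure M A < \<infinity>"
  using full unfolding full_ordered_core_def ordered_core_def by simp

text \<open>Fullness puts the whole space into the \<open>\<sigma>\<close>-ring, as a countable union of core sets.\<close>

lemma generated_sigma_ring_eq: "generated_sigma_ring \<A> = sigma_sets (space M) \<A>"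
proof (intro antisym subsetI)
  interpret S: sigma_algebra "space M" "sigma_sets (space M) \<A>"
    using core_sets by (intro sigma_algebra_sigma_sets)
  show "X \<in> sigma_sets (space M) \<A>" if "X \<in> generated_sigma_ring \<A>" for X
    using that by induction auto
  have space: "space M \<in> generated_sigma_ring \<A>"
  proof -
    obtain \<A>0 where A0: "\<A>0 \<subseteq> \<A>" "countable \<A>0" "space M = \<Union>\<A>0"
      using full unfolding full_ordered_core_def sigma_bounded_def by auto
    show ?thesis
    proof (cases "\<A>0 = {}")
      case True
      then show ?thesis using A0 by (auto intro: generated_sigma_ring.empty)
    next
      case False
      have "(\<Union>i. from_nat_into \<A>0 i) \<in> generated_sigma_ring \<A>"
        using A0(1) from_nat_into[OF False]
        by (intro generated_sigma_ring.union generated_sigma_ring.basic) auto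
      then show ?thesis using A0 False by (simp add: range_from_nat_into)
    qed
  qed
  show "X \<in> generated_sigma_ring \<A>" if "X \<in> sigma_sets (space M) \<A>" for X
    using that by induction (auto intro: generated_sigma_ring.intros space)
qed

lemma core_decreasing_iff:
  "f \<in> core_decreasing M \<A> \<longleftrightarrow> f \<in> borel_measurable (sigma (space M) \<A>) \<and>
     (\<forall>u\<in>space M. \<forall>v\<in>space M. core_le \<A> u v \<longrightarrow> f v \<le> f u)"
proof -
  interpret S: sigma_algebra "space M" "sigma_sets (space M) \<A>"
    using core_sets by (intro sigma_algebra_sigma_sets)
  have "f -` B \<inter> space M \<in> sigma_sets (space M) \<A>"
    if h: "\<forall>B\<in>sets borel. 0 \<notin> B \<longrightarrow> f -` B \<inter> space M \<in> sigma_sets (space M) \<A>"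
      and B: "B \<in> sets borel" for B
  proof (cases "0 \<in> B")
    case True
    have "space M - (f -` (- B) \<inter> space M) \<in> sigma_sets (space M) \<A>"
      using h True B by (intro S.Diff) auto
    also have "space M - (f -` (- B) \<inter> space M) = f -` B \<inter> space M" by auto
    finally show ?thesis .
  qed (use h B in auto)
  then show ?thesis
    using core_sets(2) unfolding core_decreasing_def generated_sigma_ring_eq
    by (auto simp: measurable_def)
qed

lemma core_decreasing_measurable:
  "f \<in> core_decreasing M \<A> \<Longrightarrow> f \<in> borel_measurable M"
proof -
  assume "f \<in> core_decreasing M \<A>"
  then have "f \<in> borel_measurable (sigma (space M) \<A>)" by (simp add: core_decreasing_iff)
  from measurable_sets[OF this] have "f -` B \<inter> space M \<in> sigma_sets (space M) \<A>"
    if "B \<in> sets borel" for B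
    using that core_sets(2) by simp
  then show "f \<in> borel_measurable M"
    using sets.sigma_sets_subset[OF core_sets(1)] by (intro measurableI) auto
qed

lemma core_decreasing_mono_comp:
  assumes f: "f \<in> core_decreasing M \<A>" and \<phi>: "mono \<phi>"
  shows "(\<lambda>x. \<phi> (f x)) \<in> core_decreasing M \<A>"
  unfolding core_decreasing_iff
proof (intro conjI ballI impI)
  show "(\<lambda>x. \<phi> (f x)) \<in> borel_measurable (sigma (space M) \<A>)"
    using f by (intro measurable_compose[OF _ borel_measurable_mono_ennreal[OF \<phi>]])
      (simp add: core_decreasing_iff)
  show "\<phi> (f v) \<le> \<phi> (f u)" if "u \<in> space M" "v \<in> space M" "core_le \<A> u v" for u v
    using f that by (intro monoD[OF \<phi>]) (simp add: core_decreasing_iff)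
qed

lemma core_decreasing_const: "(\<lambda>_. c) \<in> core_decreasing M \<A>"
  unfolding core_decreasing_iff by simp

lemma core_decreasing_INF:
  fixes h :: "nat \<Rightarrow> 'a \<Rightarrow> ennreal"
  assumes "\<And>n. h n \<in> core_decreasing M \<A>"
  shows "(\<lambda>x. INF n. h n x) \<in> core_decreasing M \<A>"
  unfolding core_decreasing_iff
proof (intro conjI ballI impI)
  have [measurable]: "h n \<in> borel_measurable (sigma (space M) \<A>)" for n
    using assms by (simp add: core_decreasing_iff)
  show "(\<lambda>x. INF n. h n x) \<in> borel_measurable (sigma (space M) \<A>)" by measurable
  show "(INF n. h n v) \<le> (INF n. h n u)"
    if "u \<in> space M" "v \<in> space M" "core_le \<A> u v" for u v
    using assms that by (intro INF_mono') (simp add: core_decreasing_iff)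
qed

text \<open>The least majorant is an essential infimum. Core decreasing majorants are closed under countable
  infima, and \<open>h \<mapsto> \<integral> w / (1 + h)\<close> with a positive integrable weight \<open>w\<close> is finite and strictly
  decreasing up to null sets, even where \<open>h\<close> is infinite. The infimum of a sequence along
  which this functional approaches its supremum is therefore least.\<close>

lemma ex_least_core_decreasing_majorant:
  "\<exists>g'. is_least_core_decreasing_majorant M \<A> g g'"
proof -
  define S where "S = {h \<in> core_decreasing M \<A>. AE u in M. e2ennreal \<bar>g u\<bar> \<le> h u}"
  have S_top: "(\<lambda>_. top) \<in> S" by (simp add: S_def core_decreasing_const)
  have S_INF: "(\<lambda>x. INF n. h n x) \<in> S" if "\<And>n. h n \<in> S" for h :: "nat \<Rightarrow> 'a \<Rightarrow> ennreal"
  proof -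
    have "AE u in M. \<forall>n. e2ennreal \<bar>g u\<bar> \<le> h n u"
      using that by (simp add: S_def AE_all_countable)
    then have "AE u in M. e2ennreal \<bar>g u\<bar> \<le> (INF n. h n u)"
      by eventually_elim (auto intro: INF_greatest)
    then show ?thesis using that core_decreasing_INF[of h] by (simp add: S_def)
  qed
  obtain w where w[measurable]: "w \<in> borel_measurable M" and w_fin: "integral\<^sup>N M w \<noteq> \<infinity>"
    and w_pos: "\<And>x. x \<in> space M \<Longrightarrow> 0 < w x \<and> w x < \<infinity>"
    using Ex_finite_integrable_function by auto
  define I where "I h = (\<integral>\<^sup>+x. w x * inverse (1 + h x) \<partial>M)" for h
  have inv_le: "inverse (1 + c) \<le> 1" for c :: ennreal
    using inverse_le_inverse_iff_ennreal[of "1 + c" 1] by simp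
  have I_le: "I h \<le> integral\<^sup>N M w" for h
    unfolding I_def using mult_left_mono[OF inv_le] by (intro nn_integral_mono) fastforce
  obtain k where k: "range k \<subseteq> I ` S" "Sup (I ` S) = (SUP n::nat. k n)"
    using ennreal_SUP_countable_SUP[of S I] S_top by auto
  have "\<exists>h. h \<in> S \<and> k n = I h" for n using k(1) by auto
  then obtain h where h: "\<And>n. h n \<in> S" "\<And>n. k n = I (h n)" by metis
  define g' where "g' = (\<lambda>x. INF n. h n x)"
  have g'S: "g' \<in> S" unfolding g'_def using h(1) by (rule S_INF)
  have I_mono: "I h2 \<le> I h1" if "\<And>x. h1 x \<le> h2 x" for h1 h2
    unfolding I_def using that
    by (intro nn_integral_mono mult_left_mono) (auto simp: inverse_le_inverse_iff_ennreal add_left_mono)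
  have I_max: "I h' \<le> I g'" if "h' \<in> S" for h'
  proof -
    have "I h' \<le> (SUP n. k n)" unfolding k(2)[symmetric] using that by (rule SUP_upper)
    also have "\<dots> \<le> I g'"
      unfolding h(2) by (intro SUP_least I_mono) (auto simp: g'_def intro: INF_lower)
    finally show ?thesis .
  qed
  have "AE u in M. g' u \<le> h' u" if h': "h' \<in> S" for h'
  proof -
    define m where "m x = min (g' x) (h' x)" for x
    have m_eq: "m = (\<lambda>x. INF n::nat. (if n = 0 then g' x else h' x))"
    proof
      fix x
      show "m x = (INF n::nat. (if n = 0 then g' x else h' x))"
        unfolding m_def
        by (intro antisym INF_greatest min.boundedI INF_lower2[of 0] INF_lower2[of 1]) auto
    qed
    have "m \<in> S"
      unfolding m_eq using S_INF[of "\<lambda>n. if n = 0 then g' else h'"] g'S h' by (simp add: if_distribR)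
    have [measurable]: "g' \<in> borel_measurable M" "m \<in> borel_measurable M"
      using g'S \<open>m \<in> S\<close> core_decreasing_measurable by (auto simp: S_def)
    let ?a = "\<lambda>x. w x * inverse (1 + g' x)" and ?b = "\<lambda>x. w x * inverse (1 + m x)"
    have ab: "?a x \<le> ?b x" for x
      by (intro mult_left_mono) (auto simp: inverse_le_inverse_iff_ennreal m_def intro!: add_left_mono)
    have "I g' = I m"
      using I_max[OF \<open>m \<in> S\<close>] I_mono[of m g'] by (auto simp: m_def)
    have fin: "I g' \<noteq> \<infinity>" using I_le[of g'] w_fin by (auto simp: top_unique)
    have "(\<integral>\<^sup>+x. ?b x - ?a x \<partial>M) = I m - I g'"
      unfolding I_def using fin ab by (intro nn_integral_diff) (auto simp: I_def)
    also have "\<dots> = 0" using \<open>I g' = I m\<close> fin by simp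
    finally have "AE x in M. ?b x - ?a x = 0"
      by (subst (asm) nn_integral_0_iff_AE) auto
    then show ?thesis
      using AE_space
    proof eventually_elim
      case (elim x)
      have wx: "0 < w x" "w x < top" using w_pos[OF elim(2)] by auto
      have "?b x \<le> ?a x" using elim(1) by (simp add: diff_eq_0_iff_ennreal)
      then have "inverse (1 + m x) \<le> inverse (1 + g' x)"
        using wx by (subst (asm) ennreal_mult_le_mult_iff) auto
      then have "1 + g' x \<le> 1 + m x"
        by (simp only: inverse_le_inverse_iff_ennreal)
      then show "g' x \<le> h' x" by (simp add: m_def)
    qed
  qed
  then show ?thesis
    using g'S unfolding is_least_core_decreasing_majorant_def S_def by blast
qed

abbreviation maj :: "('a \<Rightarrow> real) \<Rightarrow> 'a \<Rightarrow> ennreal" where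
  "maj g \<equiv> least_core_decreasing_majorant M \<A> (\<lambda>x. ereal (g x))"

lemma maj:
  shows maj_core_decreasing: "maj g \<in> core_decreasing M \<A>"
    and maj_ge: "AE u in M. ennreal \<bar>g u\<bar> \<le> maj g u"
    and maj_least: "h \<in> core_decreasing M \<A> \<Longrightarrow> AE u in M. ennreal \<bar>g u\<bar> \<le> h u \<Longrightarrow> AE u in M. maj g u \<le> h u"
proof -
  have "is_least_core_decreasing_majorant M \<A> (\<lambda>x. ereal (g x)) (maj g)"
    unfolding least_core_decreasing_majorant_def
    using ex_least_core_decreasing_majorant by (rule someI_ex)
  then show "maj g \<in> core_decreasing M \<A>" "AE u in M. ennreal \<bar>g u\<bar> \<le> maj g u"
    "h \<in> core_decreasing M \<A> \<Longrightarrow> AE u in M. ennreal \<bar>g u\<bar> \<le> h u \<Longrightarrow> AE u in M. maj g u \<le> h u"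
    unfolding is_least_core_decreasing_majorant_def by simp_all
qed

lemma L1_tildeI:
  assumes g: "g \<in> borel_measurable M" and k: "k \<in> core_decreasing M \<A>"
    and gk: "AE u in M. ennreal \<bar>g u\<bar> \<le> k u" and C: "(\<integral>\<^sup>+u. k u \<partial>M) \<le> ennreal C" "0 \<le> C"
  shows "g \<in> fst (L1_tilde M \<A>)" "snd (L1_tilde M \<A>) g \<le> C"
proof -
  have "(\<integral>\<^sup>+u. maj g u \<partial>M) \<le> (\<integral>\<^sup>+u. k u \<partial>M)"
    using maj_least[OF k gk] by (rule nn_integral_mono_AE)
  also note C(1)
  finally have le: "(\<integral>\<^sup>+u. maj g u \<partial>M) \<le> ennreal C" .
  then show "g \<in> fst (L1_tilde M \<A>)"
    using g by (auto simp: L1_tilde_def intro: le_less_trans)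
  show "snd (L1_tilde M \<A>) g \<le> C"
    using le C(2) by (simp add: L1_tilde_def enn2real_leI)
qed

lemma L_infinityI:
  assumes g[measurable]: "g \<in> borel_measurable M" and z: "\<And>u. \<bar>g u\<bar> \<le> z" "0 \<le> z"
  shows "g \<in> fst (L_infinity M)" "snd (L_infinity M) g \<le> z"
proof -
  have le: "esssup M (\<lambda>u. ennreal \<bar>g u\<bar>) \<le> ennreal z"
    using z by (intro esssup_I) (auto intro: ennreal_leI)
  then show "g \<in> fst (L_infinity M)"
    using g by (auto simp: L_infinity_def intro: le_less_trans)
  show "snd (L_infinity M) g \<le> z"
    using le z(2) by (simp add: L_infinity_def enn2real_leI)
qed

lemma norms_nonneg: "0 \<le> snd (L1_tilde M \<A>) g" "0 \<le> snd (L_infinity M) g"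
  by (simp_all add: L1_tilde_def L_infinity_def)

abbreviation K :: "('a \<Rightarrow> real) \<Rightarrow> real \<Rightarrow> real" where
  "K \<equiv> K_functional (L1_tilde M \<A>) (L_infinity M)"

lemma K_le:
  assumes "f0 \<in> fst (L1_tilde M \<A>)" "f1 \<in> fst (L_infinity M)" "f0 + f1 = f" "0 \<le> t"
  shows "K f t \<le> snd (L1_tilde M \<A>) f0 + t * snd (L_infinity M) f1"
  unfolding K_functional_def
proof (rule cInf_lower)
  show "bdd_below {snd (L1_tilde M \<A>) f0 + t * snd (L_infinity M) f1 |f0 f1.
      f0 \<in> fst (L1_tilde M \<A>) \<and> f1 \<in> fst (L_infinity M) \<and> f0 + f1 = f}"
    using norms_nonneg \<open>0 \<le> t\<close> by (intro bdd_belowI[of _ 0]) auto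
qed (use assms in blast)

lemma K_greatest:
  assumes "f \<in> sum_space (L1_tilde M \<A>) (L_infinity M)"
    and "\<And>f0 f1. f0 \<in> fst (L1_tilde M \<A>) \<Longrightarrow> f1 \<in> fst (L_infinity M) \<Longrightarrow> f0 + f1 = f
           \<Longrightarrow> c \<le> snd (L1_tilde M \<A>) f0 + t * snd (L_infinity M) f1"
  shows "c \<le> K f t"
  unfolding K_functional_def
  using assms by (intro cInf_greatest) (auto simp: sum_space_def)

text \<open>Core decreasing functions take their larger values earlier in the core: a core set that contains
  \<open>v\<close> contains every point with a larger value, because otherwise the total order of the core
  would make that point follow \<open>v\<close>.\<close>

lemma superlevel_in_core:
  assumes f: "f \<in> core_decreasing M \<A>" and v: "v \<in> space M" "f v < z"
  obtains A where "{u\<in>space M. z \<le> f u} \<subseteq> A" "A \<in> sets M" "emeasure M A < \<infinity>"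
proof -
  obtain A where A: "A \<in> \<A>" "v \<in> A"
    using full v(1) unfolding full_ordered_core_def by auto
  have "u \<in> A" if u: "u \<in> space M" "z \<le> f u" for u
  proof -
    have "\<not> core_le \<A> v u"
      using f u v unfolding core_decreasing_iff by (meson leD less_le_trans)
    then obtain B where "B \<in> \<A>" "u \<in> B" "v \<notin> B" by (auto simp: core_le_def)
    then show ?thesis
      using A core_total[of A B] by blast
  qed
  then have "{u\<in>space M. z \<le> f u} \<subseteq> A" by blast
  then show ?thesis
    using A(1) core_sets(1) core_finite[OF A(1)] by (intro that) auto
qed

section \<open>Functions controlled by slopes\<close>

text \<open>For \<open>\<Phi>\<close> arranged in decreasing order along the half line, this is the right end of the block
  that the value \<open>\<Phi> x\<close> occupies. Taking the right end matters at atoms: with the left end, too much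
  mass would sit at small positions.\<close>

definition position :: "('a \<Rightarrow> ennreal) \<Rightarrow> 'a \<Rightarrow> ennreal" where
  "position \<Phi> x = superlevel_mass M \<Phi> (\<Phi> x)"

lemma position_measurable:
  assumes "\<Phi> \<in> borel_measurable M"
  shows "position \<Phi> \<in> borel_measurable M"
  unfolding position_def[abs_def]
  using measurable_compose[OF assms superlevel_mass_measurable[OF assms]] .

lemma emeasure_position_le:
  assumes "\<Phi> \<in> borel_measurable M"
  shows "emeasure M {x\<in>space M. position \<Phi> x \<le> \<tau>} \<le> \<tau>"
  unfolding position_def using assms by (rule emeasure_superlevel_mass_le)

lemma AE_position_pos:
  assumes "\<Phi> \<in> borel_measurable M"
  shows "AE x in M. 0 < position \<Phi> x"
proof -
  note position_measurable[OF assms, measurable]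
  have "emeasure M {x\<in>space M. position \<Phi> x \<le> 0} = 0"
    using emeasure_position_le[OF assms, of 0] by (metis le_zero_eq)
  then have "AE x in M. \<not> position \<Phi> x \<le> 0"
    by (subst AE_iff_measurable[OF _ refl]) auto
  then show ?thesis by (auto simp: zero_less_iff_neq_zero)
qed

lemma antimono_slope_excess: "antimono (\<lambda>\<tau>. left_slope G \<tau> - c)"
  by (intro antimonoI ennreal_minus_mono left_slope_antimono) auto

text \<open>The position decreases in the value of \<open>\<Phi>\<close> and slopes decrease in the position.\<close>

lemma slope_excess_core_decreasing:
  assumes \<Phi>: "\<Phi> \<in> core_decreasing M \<A>"
  shows "(\<lambda>x. left_slope G (position \<Phi> x) - c) \<in> core_decreasing M \<A>"
  unfolding position_def
proof (rule core_decreasing_mono_comp[OF \<Phi>])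
  show "mono (\<lambda>y. left_slope G (superlevel_mass M \<Phi> y) - c)"
    by (intro monoI antimonoD[OF antimono_slope_excess]
        antimonoD[OF superlevel_mass_antimono[OF core_decreasing_measurable[OF \<Phi>]]])
qed

lemma nn_integral_slope_excess_position_le:
  assumes \<Phi>: "\<Phi> \<in> borel_measurable M" and G: "nonneg_concave G"
    and z: "0 \<le> z" and C: "\<And>s. 0 \<le> s \<Longrightarrow> G s \<le> C + s * z"
  shows "(\<integral>\<^sup>+x. left_slope G (position \<Phi> x) - ennreal z \<partial>M) \<le> ennreal C"
  using nn_integral_antimono_position_le[OF sigma_finite_measure_axioms position_measurable[OF \<Phi>]
      emeasure_position_le[OF \<Phi>] antimono_slope_excess]
    nn_integral_left_slope_excess_le[OF G z C]
  by (rule order_trans)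

text \<open>Truncate \<open>g\<close> at height \<open>z\<close>, the slope of \<open>G\<close> at \<open>t\<close>. The part above \<open>z\<close> is dominated by a core
  decreasing function, whose integral is at most the height \<open>G t - t * z\<close> at which the tangent
  meets the vertical axis; the part below \<open>z\<close> contributes \<open>t * z\<close>.\<close>

lemma ex_split_below_slope:
  assumes \<Phi>: "\<Phi> \<in> core_decreasing M \<A>" and G: "nonneg_concave G"
    and g[measurable]: "g \<in> borel_measurable M"
    and le: "AE x in M. ennreal \<bar>g x\<bar> \<le> left_slope G (position \<Phi> x)" and t: "0 < t"
  obtains g0 g1 where "g0 \<in> fst (L1_tilde M \<A>)" "g1 \<in> fst (L_infinity M)" "g0 + g1 = g"
    "snd (L1_tilde M \<A>) g0 + t * snd (L_infinity M) g1 \<le> G t"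
proof -
  have "left_slope G (ennreal t) < \<infinity>" using t by (intro left_slope_finite) simp
  then obtain z where z: "left_slope G (ennreal t) = ennreal z" "0 \<le> z"
    by (cases "left_slope G (ennreal t)") auto
  define C where "C = G t - t * z"
  have C: "G s \<le> C + s * z" if "0 \<le> s" for s
    using nonneg_concave_tangent[OF G t z that] by (simp add: C_def algebra_simps)
  have C0: "0 \<le> C" using C[of 0] nonneg_concave_nonneg[OF G, of 0] by simp
  define g1 where "g1 = (\<lambda>x. max (- z) (min z (g x)))"
  define g0 where "g0 = (\<lambda>x. g x - g1 x)"
  have [measurable]: "g1 \<in> borel_measurable M" "g0 \<in> borel_measurable M"
    unfolding g1_def g0_def by measurable
  have "\<bar>g1 u\<bar> \<le> z" for u using z(2) by (auto simp: g1_def)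
  note 1 = L_infinityI[OF _ this z(2)]
  have bound: "AE u in M. ennreal \<bar>g0 u\<bar> \<le> left_slope G (position \<Phi> u) - ennreal z"
    using le
  proof eventually_elim
    case (elim u)
    have "\<bar>g0 u\<bar> \<le> max 0 (\<bar>g u\<bar> - z)" using z(2) by (auto simp: g0_def g1_def)
    then have "ennreal \<bar>g0 u\<bar> \<le> ennreal (\<bar>g u\<bar> - z)"
      by (metis ennreal_leI ennreal_max_0)
    also have "\<dots> = ennreal \<bar>g u\<bar> - ennreal z" using z(2) by (simp add: ennreal_minus)
    also have "\<dots> \<le> left_slope G (position \<Phi> u) - ennreal z"
      using elim by (intro ennreal_minus_mono) auto
    finally show ?case .
  qed
  note 0 = L1_tildeI[OF _ slope_excess_core_decreasing[OF \<Phi>] bound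
      nn_integral_slope_excess_position_le[OF core_decreasing_measurable[OF \<Phi>] G z(2) C] C0]
  show ?thesis
  proof
    show "g0 \<in> fst (L1_tilde M \<A>)" "g1 \<in> fst (L_infinity M)" by (auto intro: 0 1)
    show "g0 + g1 = g" by (auto simp: g0_def)
    have "snd (L1_tilde M \<A>) g0 \<le> C" "t * snd (L_infinity M) g1 \<le> t * z"
      using t by (auto intro!: 0 1 mult_left_mono)
    then show "snd (L1_tilde M \<A>) g0 + t * snd (L_infinity M) g1 \<le> G t"
      by (simp add: C_def)
  qed
qed

text \<open>At \<open>t = 0\<close> there is no slope to truncate at. The last clause gives bounds by \<open>G\<close> at
  arbitrarily small positive arguments instead.\<close>

lemma K_le_of_slope_bound:
  assumes "\<Phi> \<in> core_decreasing M \<A>" "nonneg_concave G" "g \<in> borel_measurable M"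
    "AE x in M. ennreal \<bar>g x\<bar> \<le> left_slope G (position \<Phi> x)"
  shows "g \<in> sum_space (L1_tilde M \<A>) (L_infinity M)"
    and "0 < t \<Longrightarrow> K g t \<le> G t"
    and "0 < t \<Longrightarrow> K g 0 \<le> G t"
proof -
  note split = ex_split_below_slope[OF assms]
  show "g \<in> sum_space (L1_tilde M \<A>) (L_infinity M)"
    by (rule split[of 1]) (auto simp: sum_space_def)
  assume t: "0 < t"
  obtain g0 g1 where g: "g0 \<in> fst (L1_tilde M \<A>)" "g1 \<in> fst (L_infinity M)" "g0 + g1 = g"
    "snd (L1_tilde M \<A>) g0 + t * snd (L_infinity M) g1 \<le> G t"
    using split[OF t] by blast
  show "K g t \<le> G t" using K_le[OF g(1-3), of t] g(4) t by simp
  have "0 \<le> t * snd (L_infinity M) g1" using t norms_nonneg by simp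
  then show "K g 0 \<le> G t" using K_le[OF g(1-3), of 0] g(4) by simp
qed

section \<open>Recovering a majorant from its K-functional\<close>

definition excess :: "('a \<Rightarrow> ennreal) \<Rightarrow> real \<Rightarrow> ennreal" where
  "excess \<Phi> y = (\<integral>\<^sup>+x. \<Phi> x - ennreal y \<partial>M)"

text \<open>The excess can be infinite at low levels; such levels do not compete in the infimum below.\<close>

definition excess_levels :: "('a \<Rightarrow> ennreal) \<Rightarrow> real set" where
  "excess_levels \<Phi> = {y. 0 \<le> y \<and> excess \<Phi> y < \<infinity>}"

text \<open>The formula for the K-functional of \<open>\<Phi>\<close> between \<open>L\<^sup>1\<close> and \<open>L\<^sup>\<infinity>\<close>: cutting at level \<open>y\<close> costs
  the integral of the part above \<open>y\<close> plus \<open>t * y\<close>. For nice \<open>\<Phi>\<close> it is the integral of the decreasing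
  rearrangement of \<open>\<Phi>\<close> from \<open>0\<close> to \<open>t\<close>.\<close>

definition excess_transform :: "('a \<Rightarrow> ennreal) \<Rightarrow> real \<Rightarrow> real" where
  "excess_transform \<Phi> t = (INF y\<in>excess_levels \<Phi>. enn2real (excess \<Phi> y) + t * y)"

lemma excess_antimono: "y \<le> z \<Longrightarrow> excess \<Phi> z \<le> excess \<Phi> y"
  unfolding excess_def by (intro nn_integral_mono ennreal_minus_mono ennreal_leI) auto

lemma excess_transform_le:
  assumes "y \<in> excess_levels \<Phi>" "0 \<le> t"
  shows "excess_transform \<Phi> t \<le> enn2real (excess \<Phi> y) + t * y"
  unfolding excess_transform_def
proof (rule cINF_lower[OF _ assms(1)])
  show "bdd_below ((\<lambda>y. enn2real (excess \<Phi> y) + t * y) ` excess_levels \<Phi>)"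
    using assms(2) by (intro bdd_belowI[of _ 0]) (auto simp: excess_levels_def)
qed

lemma excess_transform_greatest:
  assumes "excess_levels \<Phi> \<noteq> {}"
    and "\<And>y. y \<in> excess_levels \<Phi> \<Longrightarrow> c \<le> enn2real (excess \<Phi> y) + t * y"
  shows "c \<le> excess_transform \<Phi> t"
  unfolding excess_transform_def using assms by (rule cINF_greatest)

lemma nonneg_concave_excess_transform:
  assumes ne: "excess_levels \<Phi> \<noteq> {}"
  shows "nonneg_concave (excess_transform \<Phi>)"
proof (rule nonneg_concaveI)
  show "0 \<le> excess_transform \<Phi> t" if "0 \<le> t" for t
    using that by (intro excess_transform_greatest ne) (auto simp: excess_levels_def)
  fix \<alpha> \<beta> x c y :: real
  assume h: "0 \<le> x" "x \<le> c" "c \<le> y"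
    "\<alpha> + \<beta> * x \<le> excess_transform \<Phi> x" "\<alpha> + \<beta> * y \<le> excess_transform \<Phi> y"
  show "\<alpha> + \<beta> * c \<le> excess_transform \<Phi> c"
  proof (rule excess_transform_greatest[OF ne])
    fix z assume z: "z \<in> excess_levels \<Phi>"
    let ?N = "enn2real (excess \<Phi> z)"
    have x: "\<alpha> + \<beta> * x \<le> ?N + x * z" and y: "\<alpha> + \<beta> * y \<le> ?N + y * z"
      using excess_transform_le[OF z, of x] excess_transform_le[OF z, of y] h by linarith+
    show "\<alpha> + \<beta> * c \<le> ?N + c * z"
    proof (cases "\<beta> \<le> z")
      case True
      have "(z - \<beta>) * x \<le> (z - \<beta>) * c" using True h by (intro mult_left_mono) auto
      then show ?thesis using x by (simp add: algebra_simps)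
    next
      case False
      have "(\<beta> - z) * c \<le> (\<beta> - z) * y" using False h by (intro mult_left_mono) auto
      then show ?thesis using y by (simp add: algebra_simps)
    qed
  qed
qed

text \<open>Adding a constant to the majorant of \<open>f0\<close> leaves it core decreasing, so the majorant of the sum
  exceeds that of \<open>f0\<close> by no more than the norm of \<open>f1\<close>.\<close>

lemma excess_le_of_split:
  assumes f0: "f0 \<in> fst (L1_tilde M \<A>)" and f1: "f1 \<in> fst (L_infinity M)"
  shows "snd (L_infinity M) f1 \<in> excess_levels (maj (f0 + f1))"
    and "enn2real (excess (maj (f0 + f1)) (snd (L_infinity M) f1)) \<le> snd (L1_tilde M \<A>) f0"
proof -
  define y where "y = snd (L_infinity M) f1"
  have y0: "0 \<le> y" unfolding y_def by (rule norms_nonneg)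
  have "esssup M (\<lambda>u. ennreal \<bar>f1 u\<bar>) = ennreal y"
    using f1 by (simp add: y_def L_infinity_def less_top[symmetric])
  with esssup_AE[of "\<lambda>u. ennreal \<bar>f1 u\<bar>" M] have "AE u in M. ennreal \<bar>f1 u\<bar> \<le> ennreal y" by simp
  then have "AE u in M. ennreal \<bar>(f0 + f1) u\<bar> \<le> maj f0 u + ennreal y"
    using maj_ge[of f0]
  proof eventually_elim
    case (elim u)
    have "ennreal \<bar>(f0 + f1) u\<bar> \<le> ennreal (\<bar>f0 u\<bar> + \<bar>f1 u\<bar>)" by (intro ennreal_leI) auto
    also have "\<dots> = ennreal \<bar>f0 u\<bar> + ennreal \<bar>f1 u\<bar>" by simp
    also have "\<dots> \<le> maj f0 u + ennreal y" using elim by (intro add_mono)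
    finally show ?case .
  qed
  moreover have "(\<lambda>u. maj f0 u + ennreal y) \<in> core_decreasing M \<A>"
    by (intro core_decreasing_mono_comp[OF maj_core_decreasing] monoI add_right_mono)
  ultimately have "AE u in M. maj (f0 + f1) u \<le> maj f0 u + ennreal y"
    by (intro maj_least)
  then have "AE u in M. maj (f0 + f1) u - ennreal y \<le> maj f0 u"
    by eventually_elim (simp add: ennreal_minus_le_iff add.commute)
  then have le: "excess (maj (f0 + f1)) y \<le> (\<integral>\<^sup>+u. maj f0 u \<partial>M)"
    unfolding excess_def by (rule nn_integral_mono_AE)
  have fin: "(\<integral>\<^sup>+u. maj f0 u \<partial>M) < \<infinity>" using f0 by (simp add: L1_tilde_def)
  show "snd (L_infinity M) f1 \<in> excess_levels (maj (f0 + f1))"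
    using le_less_trans[OF le fin] y0 by (simp add: excess_levels_def y_def)
  show "enn2real (excess (maj (f0 + f1)) (snd (L_infinity M) f1)) \<le> snd (L1_tilde M \<A>) f0"
    using enn2real_mono[OF le] fin by (simp add: L1_tilde_def y_def)
qed

lemma excess_levels_nonempty:
  assumes "f \<in> sum_space (L1_tilde M \<A>) (L_infinity M)"
  shows "excess_levels (maj f) \<noteq> {}"
proof -
  obtain f0 f1 where "f0 \<in> fst (L1_tilde M \<A>)" "f1 \<in> fst (L_infinity M)" "f = f0 + f1"
    using assms by (auto simp: sum_space_def)
  then show ?thesis using excess_le_of_split(1) by blast
qed

lemma excess_transform_le_K:
  assumes f: "f \<in> sum_space (L1_tilde M \<A>) (L_infinity M)" and t: "0 \<le> t"
  shows "excess_transform (maj f) t \<le> K f t"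
proof (rule K_greatest[OF f])
  fix f0 f1 assume h: "f0 \<in> fst (L1_tilde M \<A>)" "f1 \<in> fst (L_infinity M)" "f0 + f1 = f"
  show "excess_transform (maj f) t \<le> snd (L1_tilde M \<A>) f0 + t * snd (L_infinity M) f1"
    using excess_transform_le[OF excess_le_of_split(1)[OF h(1,2)] t] excess_le_of_split(2)[OF h(1,2)] h(3)
    by simp
qed

lemma AE_finite_of_excess_level:
  assumes \<Phi>[measurable]: "\<Phi> \<in> borel_measurable M" and y: "y \<in> excess_levels \<Phi>"
  shows "AE x in M. \<Phi> x < \<infinity>"
proof -
  have "AE x in M. \<Phi> x - ennreal y \<noteq> \<infinity>"
    using y by (intro nn_integral_noteq_infinite) (auto simp: excess_levels_def excess_def)
  then show ?thesis
    by eventually_elim (metis ennreal_top_minus infinity_ennreal_def top.not_eq_extremum)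
qed

text \<open>The given concave functions may vanish at \<open>0\<close> and jump there. This lemma makes the K-functionals
  of the summands vanish at \<open>0\<close>.\<close>

lemma excess_transform_arbitrarily_small:
  assumes \<Phi>[measurable]: "\<Phi> \<in> borel_measurable M" and ne: "excess_levels \<Phi> \<noteq> {}" and \<epsilon>: "0 < \<epsilon>"
  obtains s where "0 < s" "excess_transform \<Phi> s < \<epsilon>"
proof -
  obtain y where y: "y \<in> excess_levels \<Phi>" using ne by blast
  have y0: "0 \<le> y" using y by (simp add: excess_levels_def)
  have "(\<lambda>n. \<integral>\<^sup>+x. \<Phi> x - ennreal (y + real n) \<partial>M) \<longlonglongrightarrow> (\<integral>\<^sup>+x. 0 \<partial>M)"
  proof (rule nn_integral_dominated_convergence)
    show "(\<integral>\<^sup>+x. \<Phi> x - ennreal y \<partial>M) < \<infinity>" using y by (simp add: excess_levels_def excess_def)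
    show "AE x in M. \<Phi> x - ennreal (y + real n) \<le> \<Phi> x - ennreal y" for n
      by (intro AE_I2 ennreal_minus_mono ennreal_leI) auto
    show "AE x in M. (\<lambda>n. \<Phi> x - ennreal (y + real n)) \<longlonglongrightarrow> 0"
      using AE_finite_of_excess_level[OF \<Phi> y]
    proof eventually_elim
      case (elim x)
      then obtain r where r: "\<Phi> x = ennreal r" "0 \<le> r" by (cases "\<Phi> x") auto
      obtain m where "r \<le> real m" using real_arch_simple by blast
      then have "\<Phi> x - ennreal (y + real n) = 0" if "m \<le> n" for n
        using r y0 that by (simp add: ennreal_minus ennreal_eq_0_iff del: ennreal_plus)
      then show ?case by (intro tendsto_eventually) (auto simp: eventually_sequentially)
    qed
  qed auto
  then have "(\<lambda>n. excess \<Phi> (y + real n)) \<longlonglongrightarrow> 0" by (simp add: excess_def)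
  then have "\<forall>\<^sub>F n in sequentially. excess \<Phi> (y + real n) < ennreal (\<epsilon> / 2)"
    using \<epsilon> by (intro order_tendstoD(2)[of _ 0]) auto
  then obtain n where n: "excess \<Phi> (y + real n) < ennreal (\<epsilon> / 2)"
    by (auto simp: eventually_sequentially)
  define z where "z = y + real n"
  have z: "0 \<le> z" "z \<in> excess_levels \<Phi>"
    using n y0 by (auto simp: z_def excess_levels_def intro: less_trans)
  have N: "enn2real (excess \<Phi> z) < \<epsilon> / 2"
    using n \<epsilon> unfolding z_def by (cases "excess \<Phi> (y + real n)") (auto simp: ennreal_less_iff)
  define s where "s = \<epsilon> / (2 * (z + 1))"
  have s: "0 < s" "s * (z + 1) = \<epsilon> / 2" using \<epsilon> z(1) by (auto simp: s_def field_simps)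
  have "excess_transform \<Phi> s \<le> enn2real (excess \<Phi> z) + s * z"
    using s by (intro excess_transform_le z) auto
  also have "\<dots> < \<epsilon>" using N s by (simp add: algebra_simps)
  finally show ?thesis using that s(1) by blast
qed

text \<open>Lowering the level from \<open>y\<close> to \<open>z\<close> gains at least \<open>y - z\<close> on the whole set where \<open>\<Phi> \<ge> y\<close>. For
  \<open>r\<close> not above the mass of that set, levels below \<open>y\<close> thus do no better than \<open>y\<close> in the infimum
  at \<open>r\<close>, and levels from \<open>y\<close> upwards contribute functions of slope at least \<open>y\<close>.\<close>

lemma le_left_slope_excess_transform:
  assumes \<Phi>[measurable]: "\<Phi> \<in> borel_measurable M" and ne: "excess_levels \<Phi> \<noteq> {}" and y: "0 \<le> y"
  shows "ennreal y \<le> left_slope (excess_transform \<Phi>) (superlevel_mass M \<Phi> (ennreal y))"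
proof (rule le_left_slopeI)
  let ?F = "excess_transform \<Phi>"
  fix s r assume h: "0 \<le> s" "s < r" "ennreal r \<le> superlevel_mass M \<Phi> (ennreal y)"
  have "?F s + y * (r - s) \<le> ?F r"
  proof (rule excess_transform_greatest[OF ne])
    fix z assume z: "z \<in> excess_levels \<Phi>"
    show "?F s + y * (r - s) \<le> enn2real (excess \<Phi> z) + r * z"
    proof (cases "y \<le> z")
      case True
      have "y * (r - s) \<le> z * (r - s)" using True h by (intro mult_right_mono) auto
      moreover have "?F s \<le> enn2real (excess \<Phi> z) + s * z"
        by (rule excess_transform_le[OF z h(1)])
      ultimately show ?thesis by (simp add: algebra_simps)
    next
      case False
      have z0: "0 \<le> z" and fin: "excess \<Phi> z < \<infinity>" using z by (auto simp: excess_levels_def)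
      have yl: "y \<in> excess_levels \<Phi>"
        using excess_antimono[of z y \<Phi>] fin y False by (auto simp: excess_levels_def)
      let ?S = "{u\<in>space M. ennreal y \<le> \<Phi> u}"
      have "ennreal (y - z) * ennreal r + excess \<Phi> y
          \<le> ennreal (y - z) * emeasure M ?S + excess \<Phi> y"
        using h(3) unfolding superlevel_mass_def by (intro add_right_mono mult_left_mono) auto
      also have "\<dots> = (\<integral>\<^sup>+u. ennreal (y - z) * indicator ?S u + (\<Phi> u - ennreal y) \<partial>M)"
        unfolding excess_def by (subst nn_integral_add) (auto simp: nn_integral_cmult_indicator)
      also have "\<dots> \<le> excess \<Phi> z"
        unfolding excess_def
      proof (intro nn_integral_mono)
        fix u
        show "ennreal (y - z) * indicator ?S u + (\<Phi> u - ennreal y) \<le> \<Phi> u - ennreal z"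
        proof (cases "u \<in> ?S")
          case True
          then show ?thesis
            using z0 False by (cases "\<Phi> u") (auto simp: ennreal_minus simp flip: ennreal_plus)
        next
          case notin: False
          then show ?thesis using False by (auto intro!: ennreal_minus_mono ennreal_leI)
        qed
      qed
      finally have "enn2real (ennreal (y - z) * ennreal r + excess \<Phi> y) \<le> enn2real (excess \<Phi> z)"
        using fin by (intro enn2real_mono) auto
      then have "(y - z) * r + enn2real (excess \<Phi> y) \<le> enn2real (excess \<Phi> z)"
        using False h yl
        by (subst (asm) enn2real_plus) (auto simp: excess_levels_def ennreal_mult_less_top enn2real_mult)
      moreover have "?F s \<le> enn2real (excess \<Phi> y) + s * y"
        by (rule excess_transform_le[OF yl h(1)])
      ultimately show ?thesis by (simp add: algebra_simps)
    qed
  qed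
  then show "ennreal y \<le> ennreal ((?F r - ?F s) / (r - s))"
    using h by (intro ennreal_leI) (simp add: field_simps)
qed

text \<open>Here the core enters decisively: beyond a set of finite measure, \<open>\<Phi>\<close> stays below any level
  \<open>z\<close> that exceeds one of its values. Without this, \<open>\<Phi>\<close> could have infinite mass above \<open>z\<close> and values
  below \<open>z\<close> that its excess transform does not see.\<close>

lemma excess_level_above_value:
  assumes \<Phi>: "\<Phi> \<in> core_decreasing M \<A>" and ne: "excess_levels \<Phi> \<noteq> {}"
    and v: "v \<in> space M" "\<Phi> v < ennreal z" and z: "0 \<le> z"
  shows "z \<in> excess_levels \<Phi>"
proof -
  note core_decreasing_measurable[OF \<Phi>, measurable]
  obtain y where y: "0 \<le> y" "excess \<Phi> y < \<infinity>" using ne by (auto simp: excess_levels_def)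
  obtain A where A: "{u\<in>space M. ennreal z \<le> \<Phi> u} \<subseteq> A" and [measurable]: "A \<in> sets M"
    and fin: "emeasure M A < \<infinity>"
    using superlevel_in_core[OF \<Phi> v] .
  have "excess \<Phi> z \<le> (\<integral>\<^sup>+u. (\<Phi> u - ennreal y) + ennreal y * indicator A u \<partial>M)"
    unfolding excess_def
  proof (rule nn_integral_mono)
    fix u assume u: "u \<in> space M"
    show "\<Phi> u - ennreal z \<le> (\<Phi> u - ennreal y) + ennreal y * indicator A u"
    proof (cases "u \<in> A")
      case True
      have "\<Phi> u - ennreal z \<le> \<Phi> u" by (rule diff_le_self_ennreal)
      also have "\<Phi> u \<le> (\<Phi> u - ennreal y) + ennreal y"
        by (metis add.commute diff_add_cancel_ennreal le_add1 le_cases order_refl add_increasing zero_le)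
      finally show ?thesis using True by simp
    next
      case False
      then have "\<Phi> u < ennreal z" using A u by (auto simp: not_le[symmetric])
      then have "\<Phi> u - ennreal z = 0"
        by (auto simp: diff_eq_0_iff_ennreal intro: less_trans)
      then show ?thesis by simp
    qed
  qed
  also have "\<dots> = excess \<Phi> y + ennreal y * emeasure M A"
    unfolding excess_def by (subst nn_integral_add) (auto simp: nn_integral_cmult_indicator)
  also have "\<dots> < \<infinity>" using y fin by (simp add: ennreal_mult_less_top)
  finally show ?thesis using z by (simp add: excess_levels_def)
qed

text \<open>One inequality holds wherever \<open>\<Phi>\<close> is finite. Above each admissible level both sides have integrals in the
  opposite order, so they agree almost everywhere above that level; and every level above a value
  of \<open>\<Phi>\<close> is admissible.\<close>

lemma AE_eq_left_slope_excess_transform: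
  assumes \<Phi>: "\<Phi> \<in> core_decreasing M \<A>" and ne: "excess_levels \<Phi> \<noteq> {}"
  shows "AE x in M. \<Phi> x = left_slope (excess_transform \<Phi>) (position \<Phi> x)"
proof -
  let ?D = "\<lambda>x. left_slope (excess_transform \<Phi>) (position \<Phi> x)"
  note \<Phi>m = core_decreasing_measurable[OF \<Phi>]
  note [measurable] = \<Phi>m
  have [measurable]: "?D \<in> borel_measurable M"
    using core_decreasing_measurable[OF slope_excess_core_decreasing[OF \<Phi>, of "excess_transform \<Phi>" 0]]
    by simp
  obtain y where "y \<in> excess_levels \<Phi>" using ne by blast
  note fin = AE_finite_of_excess_level[OF \<Phi>m this]
  have le: "\<Phi> x \<le> ?D x" if fin_x: "\<Phi> x < \<infinity>" for x
  proof -
    obtain r where "\<Phi> x = ennreal r" "0 \<le> r" using fin_x by (cases "\<Phi> x") auto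
    then show ?thesis
      using le_left_slope_excess_transform[OF \<Phi>m ne, of r] by (simp add: position_def)
  qed
  have "AE x in M. ?D x - ennreal z \<le> \<Phi> x - ennreal z" if z: "z \<in> excess_levels \<Phi>" for z
  proof -
    let ?a = "\<lambda>x. \<Phi> x - ennreal z" and ?b = "\<lambda>x. ?D x - ennreal z"
    have z0: "0 \<le> z" and Nz: "(\<integral>\<^sup>+x. ?a x \<partial>M) < \<infinity>"
      using z by (auto simp: excess_levels_def excess_def)
    have ab: "AE x in M. ?a x \<le> ?b x"
      using fin by eventually_elim (rule ennreal_minus_mono[OF le order_refl])
    have "(\<integral>\<^sup>+x. ?b x \<partial>M) \<le> ennreal (enn2real (excess \<Phi> z))"
      by (intro nn_integral_slope_excess_position_le[OF \<Phi>m nonneg_concave_excess_transform[OF ne] z0]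
          excess_transform_le z)
    also have "\<dots> = (\<integral>\<^sup>+x. ?a x \<partial>M)" using Nz by (simp add: excess_def)
    finally have "(\<integral>\<^sup>+x. ?b x \<partial>M) - (\<integral>\<^sup>+x. ?a x \<partial>M) = 0"
      using Nz by (simp add: diff_eq_0_iff_ennreal)
    then have "(\<integral>\<^sup>+x. ?b x - ?a x \<partial>M) = 0"
      using Nz ab by (subst nn_integral_diff) auto
    then have "AE x in M. ?b x - ?a x = 0"
      by (subst (asm) nn_integral_0_iff_AE) auto
    then show ?thesis by eventually_elim (simp add: diff_eq_0_iff_ennreal)
  qed
  then have "AE x in M. \<forall>q::rat. real_of_rat q \<in> excess_levels \<Phi> \<longrightarrow>
      ?D x - ennreal (real_of_rat q) \<le> \<Phi> x - ennreal (real_of_rat q)"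
    by (auto simp: AE_all_countable)
  then show ?thesis
    using fin AE_space
  proof eventually_elim
    case (elim x)
    show ?case
    proof (rule ccontr)
      assume "\<Phi> x \<noteq> ?D x"
      then have "\<Phi> x < ?D x" using le[OF elim(2)] by simp
      then obtain q :: rat where q: "\<Phi> x < ennreal (real_of_rat q)" "ennreal (real_of_rat q) < ?D x"
        using ennreal_rat_dense by blast
      have "0 \<le> real_of_rat q" using q(1) by (cases "0 \<le> real_of_rat q") (auto simp: ennreal_neg)
      then have "real_of_rat q \<in> excess_levels \<Phi>"
        using excess_level_above_value[OF \<Phi> ne elim(3) q(1)] by simp
      then have "?D x - ennreal (real_of_rat q) \<le> \<Phi> x - ennreal (real_of_rat q)"
        using elim(1) by blast
      also have "\<dots> = 0" using q(1) by (auto simp: diff_eq_0_iff_ennreal intro: less_trans)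
      finally show False using q(2) by (simp add: diff_eq_0_iff_ennreal not_less[symmetric])
    qed
  qed
qed

section \<open>Divisibility\<close>

text \<open>Each summand of \<open>F\<close> yields a share of \<open>f\<close>: the fraction of the slope of \<open>F\<close> that the slope of the
  summand makes up at the same position. The shares are proportional to \<open>f\<close>, so their absolute
  values stay below the corresponding slopes, and what remains after \<open>n\<close> steps is bounded by the
  slope of the remainder \<open>R n\<close>.\<close>

lemma divisibility:
  assumes f: "f \<in> sum_space (L1_tilde M \<A>) (L_infinity M)"
    and w: "\<And>j. nonneg_concave (w j)" and sm: "summable (\<lambda>j. w j 1)"
    and le: "\<And>t. 0 \<le> t \<Longrightarrow> K f t \<le> (\<Sum>j. w j t)"
  obtains g where "\<And>j. g j \<in> sum_space (L1_tilde M \<A>) (L_infinity M)"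
    "\<And>j t. 0 \<le> t \<Longrightarrow> K (g j) t \<le> w j t" "(\<lambda>n. K ((\<Sum>j<n. g j) - f) 1) \<longlonglongrightarrow> 0"
proof -
  define \<Phi> where "\<Phi> = maj f"
  have \<Phi>: "\<Phi> \<in> core_decreasing M \<A>" unfolding \<Phi>_def by (rule maj_core_decreasing)
  note \<Phi>m[measurable] = core_decreasing_measurable[OF \<Phi>]
  note position_measurable[OF \<Phi>m, measurable]
  have fm[measurable]: "f \<in> borel_measurable M"
    using f by (auto simp: sum_space_def L1_tilde_def L_infinity_def plus_fun_def)
  have ne: "excess_levels \<Phi> \<noteq> {}" unfolding \<Phi>_def using f by (rule excess_levels_nonempty)
  define F where "F = excess_transform \<Phi>"
  have F: "nonneg_concave F" unfolding F_def by (rule nonneg_concave_excess_transform[OF ne])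
  have Fle: "F t \<le> (\<Sum>j. w j t)" if "0 \<le> t" for t
    using excess_transform_le_K[OF f that] le[OF that] by (simp add: F_def \<Phi>_def)
  obtain R where R: "R 0 = F" "\<And>n. nonneg_concave (R n)"
    "\<And>n. nonneg_concave (\<lambda>t. R n t - R (Suc n) t)"
    "\<And>n t. 0 \<le> t \<Longrightarrow> R n t - R (Suc n) t \<le> w n t" "(\<lambda>n. R n 1) \<longlonglongrightarrow> 0"
    using nonneg_concave_countable_decomposition[OF F w sm Fle] by blast
  define E where "E n t = R n t - R (Suc n) t" for n t
  have E: "nonneg_concave (E n)" for n unfolding E_def[abs_def] by (rule R(3))
  have RF: "R n t \<le> F t" if "0 \<le> t" for n t
  proof (induction n)
    case (Suc n)
    then show ?case using nonneg_concave_nonneg[OF E that, of n] by (simp add: E_def)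
  qed (simp add: R(1))
  define d where "d n x = enn2real (left_slope (R n) (position \<Phi> x))" for n x
  define e where "e n x = enn2real (left_slope (E n) (position \<Phi> x))" for n x
  have slope_meas[measurable]: "(\<lambda>x. left_slope G (position \<Phi> x)) \<in> borel_measurable M" for G
    using core_decreasing_measurable[OF slope_excess_core_decreasing[OF \<Phi>, of G 0]] by simp
  have [measurable]: "d n \<in> borel_measurable M" "e n \<in> borel_measurable M" for n
    unfolding d_def[abs_def] e_def[abs_def] by measurable
  have nn: "0 \<le> d n x" "0 \<le> e n x" for n x by (simp_all add: d_def e_def)
  have pos: "AE x in M. 0 < position \<Phi> x" by (rule AE_position_pos[OF \<Phi>m])
  have slope_d: "left_slope (R n) (position \<Phi> x) = ennreal (d n x)"
    and slope_e: "left_slope (E n) (position \<Phi> x) = ennreal (e n x)"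
    and d_Suc: "d n x = e n x + d (Suc n) x" if "0 < position \<Phi> x" for n x
  proof -
    show d: "left_slope (R n) (position \<Phi> x) = ennreal (d n x)" for n
      using left_slope_finite[OF that] by (simp add: d_def less_top[symmetric])
    show e: "left_slope (E n) (position \<Phi> x) = ennreal (e n x)"
      using left_slope_finite[OF that] by (simp add: e_def less_top[symmetric])
    have "ennreal (d n x) = ennreal (e n x) + ennreal (d (Suc n) x)"
      unfolding d[symmetric] e[symmetric]
      by (rule left_slope_add[OF E R(2)]) (simp add: E_def)
    then show "d n x = e n x + d (Suc n) x"
      using nn by (simp flip: ennreal_plus)
  qed
  have f_le: "AE x in M. \<bar>f x\<bar> \<le> d 0 x"
    using maj_ge[of f] AE_eq_left_slope_excess_transform[OF \<Phi> ne] pos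
  proof eventually_elim
    case (elim x)
    then have "ennreal \<bar>f x\<bar> \<le> ennreal (d 0 x)"
      using slope_d[of x 0] by (simp add: \<Phi>_def R(1) F_def)
    then show ?case using nn by simp
  qed
  define g where "g n x = f x / d 0 x * e n x" for n x
  have [measurable]: "g n \<in> borel_measurable M" for n unfolding g_def[abs_def] by measurable
  have ratio: "\<bar>f x / d 0 x * c\<bar> \<le> c" if "\<bar>f x\<bar> \<le> d 0 x" "0 \<le> c" for c x
  proof -
    have "\<bar>f x / d 0 x\<bar> \<le> 1" using that by (cases "d 0 x = 0") (auto simp: abs_divide divide_le_eq_1)
    then show ?thesis using mult_right_mono[OF _ that(2), of "\<bar>f x / d 0 x\<bar>" 1] that(2) by (simp add: abs_mult)
  qed
  have g_le: "AE x in M. ennreal \<bar>g n x\<bar> \<le> left_slope (E n) (position \<Phi> x)" for n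
    using f_le pos
  proof eventually_elim
    case (elim x)
    then show ?case
      using ratio[OF elim(1) nn(2), of n] by (simp add: g_def slope_e ennreal_leI)
  qed
  note g_bound = K_le_of_slope_bound[OF \<Phi> E _ g_le]
  \<comment> \<open>Where the slope \<open>d 0 x\<close> vanishes, so does \<open>f x\<close>, and division by zero returns the right value.\<close>
  have partial: "((\<Sum>j<n. g j) - f) x = - (f x / d 0 x * d n x)"
    if "\<bar>f x\<bar> \<le> d 0 x" "0 < position \<Phi> x" for n x
  proof (induction n)
    case 0
    show ?case using that(1) by (cases "d 0 x = 0") auto
  next
    case (Suc n)
    then show ?case using d_Suc[OF that(2), of n] by (simp add: g_def algebra_simps)
  qed
  have rest_le: "AE x in M. ennreal \<bar>((\<Sum>j<n. g j) - f) x\<bar> \<le> left_slope (R n) (position \<Phi> x)" for n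
    using f_le pos
  proof eventually_elim
    case (elim x)
    then show ?case
      using ratio[OF elim(1) nn(1), of n] by (simp only: partial abs_minus_cancel slope_d ennreal_leI)
  qed
  have rest_meas: "(\<Sum>j<n. g j) - f \<in> borel_measurable M" for n
  proof -
    have "(\<Sum>j<n. g j) - f = (\<lambda>x. (\<Sum>j<n. g j x) - f x)"
      by (induction n) (auto simp: fun_eq_iff)
    then show ?thesis by simp
  qed
  show ?thesis
  proof
    show "g j \<in> sum_space (L1_tilde M \<A>) (L_infinity M)" for j by (rule g_bound(1)) simp
    show "K (g j) t \<le> w j t" if "0 \<le> t" for j t
    proof (cases "t = 0")
      case False
      then have "K (g j) t \<le> E j t" using that by (intro g_bound(2)) auto
      then show ?thesis using R(4)[OF that, of j] by (simp add: E_def)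
    next
      case True
      have "K (g j) 0 \<le> 0"
      proof (rule field_le_epsilon)
        fix \<epsilon> :: real assume "0 < \<epsilon>"
        then obtain s where s: "0 < s" "F s < \<epsilon>"
          unfolding F_def using excess_transform_arbitrarily_small[OF \<Phi>m ne] by blast
        have "K (g j) 0 \<le> E j s" using s(1) by (intro g_bound(3)) auto
        also have "\<dots> \<le> F s"
          using RF[of s j] nonneg_concave_nonneg[OF R(2), of s "Suc j"] s(1) by (simp add: E_def)
        finally show "K (g j) 0 \<le> 0 + \<epsilon>" using s(2) by simp
      qed
      also have "0 \<le> w j 0" using nonneg_concave_nonneg[OF w] by simp
      finally show ?thesis using True by simp
    qed
    have "K ((\<Sum>j<n. g j) - f) 1 \<le> R n 1" for n
      by (rule K_le_of_slope_bound(2)[OF \<Phi> R(2) rest_meas rest_le]) simp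
    moreover have "0 \<le> K ((\<Sum>j<n. g j) - f) 1" for n
      by (rule K_greatest[OF K_le_of_slope_bound(1)[OF \<Phi> R(2) rest_meas rest_le]])
        (use norms_nonneg in auto)
    ultimately show "(\<lambda>n. K ((\<Sum>j<n. g j) - f) 1) \<longlonglongrightarrow> 0"
      by (intro tendsto_sandwich[OF _ _ tendsto_const R(5)]) auto
  qed
qed

end

theorem lemma8p9:
  fixes M :: "'a measure" and \<A> :: "'a set set"
  assumes "sigma_finite_measure M"
    and "full_ordered_core M \<A>"
  shows "has_divisibility_constant_1 (L1_tilde M \<A>) (L_infinity M)"
proof -
  interpret full_core_space M \<A>
    using assms by (simp add: full_core_space_def full_core_space_axioms_def)
  show ?thesis
    unfolding has_divisibility_constant_1_def sum_norm_def
  proof (intro ballI allI impI)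
    fix f and w :: "nat \<Rightarrow> real \<Rightarrow> real"
    assume h: "f \<in> sum_space (L1_tilde M \<A>) (L_infinity M)"
      "\<forall>j. (\<forall>t\<ge>0. 0 \<le> w j t) \<and> concave_on {0..} (w j)" "summable (\<lambda>j. w j 1)"
      "\<forall>t\<ge>0. K f t \<le> (\<Sum>j. w j t)"
    have w: "nonneg_concave (w j)" for j using h(2) by (simp add: nonneg_concave_def)
    have le: "K f t \<le> (\<Sum>j. w j t)" if "0 \<le> t" for t using h(4) that by simp
    obtain g where "\<And>j. g j \<in> sum_space (L1_tilde M \<A>) (L_infinity M)"
      "\<And>j t. 0 \<le> t \<Longrightarrow> K (g j) t \<le> w j t" "(\<lambda>n. K ((\<Sum>j<n. g j) - f) 1) \<longlonglongrightarrow> 0"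
      using divisibility[OF h(1) w h(3) le] by blast
    then show "\<exists>g. (\<forall>j. g j \<in> sum_space (L1_tilde M \<A>) (L_infinity M)) \<and>
        (\<forall>j. \<forall>t\<ge>0. K (g j) t \<le> w j t) \<and> (\<lambda>n. K ((\<Sum>j<n. g j) - f) 1) \<longlonglongrightarrow> 0"
      by blast
  qed
qed

end
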